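(* For every infinite finitely generated group $G$ we have $$\alpha^*(G)\ge \tfrac{1}{2}\implies \alpha^*(G\wr \mathbb{Z})\ge \frac{2\alpha^*(G)}{2\alpha^*(G)+1},$$ and $$\alpha^*(G)\le \tfrac{1}{2}\implies \alpha^*(G\wr \mathbb{Z})= \alpha^*(G).$$
   Context: For a finitely generated group $G$ with left-invariant word metric $d_G$ (induced by a finite symmetric generating set), the Hilbert compression exponent $\alpha^*(G)$ is the supremum of all $\alpha\ge 0$ for which there exist a Lipschitz map $f:G\to L_2$ and $c>0$ with $\|f(x)-f(y)\|_2\ge c\,d_G(x,y)^\alpha$ for all distinct $x,y\in G$. It does not depend on the generating set. The wreath product $G\wr H$ is the group of all pairs $(f,x)$ with $f:H\to G$ finitely supported (i.e. $f(z)=e_G$ for all but finitely many $z$) and $x\in H$, with product $(f,x)(g,y)=(z\mapsto f(z)g(x^{-1}z),\,xy)$. *)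

theory Defs
  imports "HOL-Analysis.Analysis" "HOL-Algebra.Algebra"
begin

definition finite_symmetric_generating_set :: "('a, 'b) monoid_scheme \<Rightarrow> 'a set \<Rightarrow> bool" where
  "finite_symmetric_generating_set G S \<longleftrightarrow>
     finite S \<and> S \<subseteq> carrier G \<and> (\<forall>s\<in>S. inv\<^bsub>G\<^esub> s \<in> S) \<and> generate G S = carrier G"

text \<open>For a symmetric generating set \<open>S\<close> every group element is the value of some word in \<open>S\<close>.
  Without these hypotheses the \<open>LEAST\<close> may range over the empty set.\<close>

definition word_length :: "('a, 'b) monoid_scheme \<Rightarrow> 'a set \<Rightarrow> 'a \<Rightarrow> nat" where
  "word_length G S g =
     (LEAST n. \<exists>w. set w \<subseteq> S \<and> length w = n \<and> foldr (\<otimes>\<^bsub>G\<^esub>) w \<one>\<^bsub>G\<^esub> = g)"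

definition word_dist :: "('a, 'b) monoid_scheme \<Rightarrow> 'a set \<Rightarrow> 'a \<Rightarrow> 'a \<Rightarrow> nat" where
  "word_dist G S x y = word_length G S (inv\<^bsub>G\<^esub> x \<otimes>\<^bsub>G\<^esub> y)"

text \<open>Real \<open>L\<^sub>2\<close> over the unit interval. Elements are represented by functions rather than by classes
  modulo null sets, so \<open>L2_dist\<close> is a pseudometric; choosing representatives shows that this does
  not affect which maps into \<open>L\<^sub>2\<close> exist.\<close>

definition L2 :: "(real \<Rightarrow> real) set" where
  "L2 = {u \<in> borel_measurable (lebesgue_on {0..1}). integrable (lebesgue_on {0..1}) (\<lambda>t. (u t)\<^sup>2)}"

definition L2_dist :: "(real \<Rightarrow> real) \<Rightarrow> (real \<Rightarrow> real) \<Rightarrow> real" where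
  "L2_dist u v = sqrt (\<integral>t. (u t - v t)\<^sup>2 \<partial>lebesgue_on {0..1})"

definition compression_exponents :: "('a, 'b) monoid_scheme \<Rightarrow> 'a set \<Rightarrow> real set" where
  "compression_exponents G S = {\<alpha>. 0 \<le> \<alpha> \<and>
     (\<exists>f L c. f \<in> carrier G \<rightarrow> L2 \<and> 0 < c \<and>
        (\<forall>x\<in>carrier G. \<forall>y\<in>carrier G. L2_dist (f x) (f y) \<le> L * real (word_dist G S x y)) \<and>
        (\<forall>x\<in>carrier G. \<forall>y\<in>carrier G. x \<noteq> y \<longrightarrow>
           c * real (word_dist G S x y) powr \<alpha> \<le> L2_dist (f x) (f y)))}"

text \<open>The supremum is taken in the reals. For an infinite finitely generated group the set contains
  \<open>0\<close> (send the elements to an orthonormal system) and is bounded by \<open>1\<close> (the word metric is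
  unbounded and the map is Lipschitz). For a finite group the set is unbounded and
  the value below is meaningless.\<close>

definition hilbert_compression :: "('a, 'b) monoid_scheme \<Rightarrow> 'a set \<Rightarrow> real" where
  "hilbert_compression G S = Sup (compression_exponents G S)"

text \<open>Functions on \<open>carrier H\<close> are represented by their extensional representatives.\<close>

definition wreath_product ::
  "('a, 'b) monoid_scheme \<Rightarrow> ('h, 'c) monoid_scheme \<Rightarrow> (('h \<Rightarrow> 'a) \<times> 'h) monoid"
  (infixl \<open>\<wr>\<close> 70) where
  "G \<wr> H =
    \<lparr>carrier = {f \<in> carrier H \<rightarrow>\<^sub>E carrier G. finite {z \<in> carrier H. f z \<noteq> \<one>\<^bsub>G\<^esub>}} \<times> carrier H,
     monoid.mult = (\<lambda>(f, x) (g, y).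
       (\<lambda>z\<in>carrier H. f z \<otimes>\<^bsub>G\<^esub> g (inv\<^bsub>H\<^esub> x \<otimes>\<^bsub>H\<^esub> z), x \<otimes>\<^bsub>H\<^esub> y)),
     one = (\<lambda>z\<in>carrier H. \<one>\<^bsub>G\<^esub>, \<one>\<^bsub>H\<^esub>)\<rparr>"

lemma wreath_simps [simp]:
  "(f, x) \<in> carrier (G \<wr> H) \<longleftrightarrow> f \<in> carrier H \<rightarrow>\<^sub>E carrier G \<and>
     finite {z \<in> carrier H. f z \<noteq> \<one>\<^bsub>G\<^esub>} \<and> x \<in> carrier H"
  "(f, x) \<otimes>\<^bsub>G \<wr> H\<^esub> (g, y) =
     (\<lambda>z\<in>carrier H. f z \<otimes>\<^bsub>G\<^esub> g (inv\<^bsub>H\<^esub> x \<otimes>\<^bsub>H\<^esub> z), x \<otimes>\<^bsub>H\<^esub> y)"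
  "\<one>\<^bsub>G \<wr> H\<^esub> = (\<lambda>z\<in>carrier H. \<one>\<^bsub>G\<^esub>, \<one>\<^bsub>H\<^esub>)"
  by (auto simp: wreath_product_def)

lemma group_wreath_product:
  fixes G :: "('a, 'b) monoid_scheme" and H :: "('c, 'd) monoid_scheme"
  assumes "group G" "group H"
  shows "group (G \<wr> H)"
proof -
  interpret G: group G by fact
  interpret H: group H by fact
  have supp_restrict: "{z \<in> A. restrict u A z \<noteq> c} = {z \<in> A. u z \<noteq> c}" for A :: "'c set" and u :: "'c \<Rightarrow> 'a" and c
    by auto
  have supp_shift: "finite {z \<in> carrier H. f (x \<otimes>\<^bsub>H\<^esub> z) \<noteq> \<one>\<^bsub>G\<^esub>}"
    if "x \<in> carrier H" "finite {z \<in> carrier H. f z \<noteq> \<one>\<^bsub>G\<^esub>}" for f :: "_ \<Rightarrow> 'a" and x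
  proof -
    have "inj_on (\<lambda>z. x \<otimes>\<^bsub>H\<^esub> z) {z \<in> carrier H. f (x \<otimes>\<^bsub>H\<^esub> z) \<noteq> \<one>\<^bsub>G\<^esub>}"
      using that(1) by (auto simp: inj_on_def)
    moreover have "(\<lambda>z. x \<otimes>\<^bsub>H\<^esub> z) ` {z \<in> carrier H. f (x \<otimes>\<^bsub>H\<^esub> z) \<noteq> \<one>\<^bsub>G\<^esub>} \<subseteq> {z \<in> carrier H. f z \<noteq> \<one>\<^bsub>G\<^esub>}"
      using that(1) by auto
    ultimately show ?thesis 
      using inj_on_finite that(2) by blast
  qed
  have inv_inv_mult: "inv\<^bsub>H\<^esub> y \<otimes>\<^bsub>H\<^esub> (inv\<^bsub>H\<^esub> x \<otimes>\<^bsub>H\<^esub> z) = inv\<^bsub>H\<^esub> (x \<otimes>\<^bsub>H\<^esub> y) \<otimes>\<^bsub>H\<^esub> z"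
    if "x \<in> carrier H" "y \<in> carrier H" "z \<in> carrier H" for x y z
    using that by (simp add: H.inv_mult_group H.m_assoc)
  show ?thesis
  proof (rule groupI)
    fix p q assume "p \<in> carrier (G \<wr> H)" "q \<in> carrier (G \<wr> H)"
    then obtain f x g y where p: "p = (f, x)" "q = (g, y)"
      and f: "f \<in> carrier H \<rightarrow>\<^sub>E carrier G" "finite {z \<in> carrier H. f z \<noteq> \<one>\<^bsub>G\<^esub>}" "x \<in> carrier H"
      and g: "g \<in> carrier H \<rightarrow>\<^sub>E carrier G" "finite {z \<in> carrier H. g z \<noteq> \<one>\<^bsub>G\<^esub>}" "y \<in> carrier H"
      by (cases p; cases q) auto
    have "finite {z \<in> carrier H. g (inv\<^bsub>H\<^esub> x \<otimes>\<^bsub>H\<^esub> z) \<noteq> \<one>\<^bsub>G\<^esub>}"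
      using supp_shift f g by simp
    with f(2) have "finite ({z \<in> carrier H. f z \<noteq> \<one>\<^bsub>G\<^esub>} \<union> {z \<in> carrier H. g (inv\<^bsub>H\<^esub> x \<otimes>\<^bsub>H\<^esub> z) \<noteq> \<one>\<^bsub>G\<^esub>})"
      by simp
    then have "finite {z \<in> carrier H. f z \<otimes>\<^bsub>G\<^esub> g (inv\<^bsub>H\<^esub> x \<otimes>\<^bsub>H\<^esub> z) \<noteq> \<one>\<^bsub>G\<^esub>}"
      by (rule rev_finite_subset) (use f g in \<open>auto simp: PiE_iff\<close>)
    then show "p \<otimes>\<^bsub>G \<wr> H\<^esub> q \<in> carrier (G \<wr> H)"
      using f g by (simp add: p PiE_iff supp_restrict restrict_apply' del: restrict_apply)
  next
    show "\<one>\<^bsub>G \<wr> H\<^esub> \<in> carrier (G \<wr> H)"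
      by (simp add: PiE_iff supp_restrict restrict_apply' del: restrict_apply)
  next
    fix p q r assume "p \<in> carrier (G \<wr> H)" "q \<in> carrier (G \<wr> H)" "r \<in> carrier (G \<wr> H)"
    then obtain f x g y h w where p: "p = (f, x)" "q = (g, y)" "r = (h, w)"
      and mem: "f \<in> carrier H \<rightarrow> carrier G" "g \<in> carrier H \<rightarrow> carrier G" "h \<in> carrier H \<rightarrow> carrier G"
        "x \<in> carrier H" "y \<in> carrier H" "w \<in> carrier H"
      by (cases p; cases q; cases r) (simp add: PiE_iff Pi_iff)
    have "f z \<otimes>\<^bsub>G\<^esub> g (inv\<^bsub>H\<^esub> x \<otimes>\<^bsub>H\<^esub> z) \<otimes>\<^bsub>G\<^esub> h (inv\<^bsub>H\<^esub> (x \<otimes>\<^bsub>H\<^esub> y) \<otimes>\<^bsub>H\<^esub> z) =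
        f z \<otimes>\<^bsub>G\<^esub> (g (inv\<^bsub>H\<^esub> x \<otimes>\<^bsub>H\<^esub> z) \<otimes>\<^bsub>G\<^esub> h (inv\<^bsub>H\<^esub> y \<otimes>\<^bsub>H\<^esub> (inv\<^bsub>H\<^esub> x \<otimes>\<^bsub>H\<^esub> z)))"
      if "z \<in> carrier H" for z
      using that mem by (simp add: G.m_assoc inv_inv_mult Pi_iff)
    with mem show "p \<otimes>\<^bsub>G \<wr> H\<^esub> q \<otimes>\<^bsub>G \<wr> H\<^esub> r = p \<otimes>\<^bsub>G \<wr> H\<^esub> (q \<otimes>\<^bsub>G \<wr> H\<^esub> r)"
      by (simp add: p H.m_assoc cong: restrict_cong)
  next
    fix p assume "p \<in> carrier (G \<wr> H)"
    then obtain f x where p: "p = (f, x)" and f: "f \<in> carrier H \<rightarrow>\<^sub>E carrier G" "x \<in> carrier H"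
      by (cases p) simp
    have "(\<lambda>z\<in>carrier H. \<one>\<^bsub>G\<^esub> \<otimes>\<^bsub>G\<^esub> f z) = restrict f (carrier H)"
      using f(1) by (intro restrict_ext) (simp add: PiE_iff)
    with f show "\<one>\<^bsub>G \<wr> H\<^esub> \<otimes>\<^bsub>G \<wr> H\<^esub> p = p"
      by (simp add: p PiE_iff extensional_restrict cong: restrict_cong)
  next
    fix p assume "p \<in> carrier (G \<wr> H)"
    then obtain f x where p: "p = (f, x)"
      and f: "f \<in> carrier H \<rightarrow>\<^sub>E carrier G" "finite {z \<in> carrier H. f z \<noteq> \<one>\<^bsub>G\<^esub>}" "x \<in> carrier H"
      by (cases p) auto
    define q where "q = (\<lambda>z\<in>carrier H. inv\<^bsub>G\<^esub> f (x \<otimes>\<^bsub>H\<^esub> z), inv\<^bsub>H\<^esub> x)"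
    have "finite {z \<in> carrier H. inv\<^bsub>G\<^esub> f (x \<otimes>\<^bsub>H\<^esub> z) \<noteq> \<one>\<^bsub>G\<^esub>}"
      using supp_shift[OF f(3,2)] by (rule rev_finite_subset) auto
    then have "q \<in> carrier (G \<wr> H)"
      using f by (simp add: q_def PiE_iff supp_restrict restrict_apply' del: restrict_apply)
    moreover have "q \<otimes>\<^bsub>G \<wr> H\<^esub> p = \<one>\<^bsub>G \<wr> H\<^esub>"
      using f by (simp add: p q_def PiE_iff cong: restrict_cong)
    ultimately show "\<exists>y\<in>carrier (G \<wr> H). y \<otimes>\<^bsub>G \<wr> H\<^esub> p = \<one>\<^bsub>G \<wr> H\<^esub>" by blast
  qed
qed

text \<open>Wreath products of finitely generated groups are finitely generated, so that word metrics on them exist.\<close>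

lemma wreath_product_finitely_generated:
  fixes G :: "('a, 'b) monoid_scheme" and H :: "('c, 'd) monoid_scheme"
  assumes "group G" "group H"
    and S: "finite_symmetric_generating_set G S" and T: "finite_symmetric_generating_set H T"
  shows "\<exists>U. finite_symmetric_generating_set (G \<wr> H) U"
proof -
  interpret G: group G by fact
  interpret H: group H by fact
  interpret W: group "G \<wr> H" by (rule group_wreath_product) fact+
  define lamp where
    "lamp h g = (\<lambda>z\<in>carrier H. if z = h then g else \<one>\<^bsub>G\<^esub>, \<one>\<^bsub>H\<^esub>)" for h :: 'c and g :: 'a
  define pos where "pos x = (\<lambda>z\<in>carrier H. \<one>\<^bsub>G\<^esub>, x)" for x :: 'c
  have lamp_in: "lamp h g \<in> carrier (G \<wr> H)" if "g \<in> carrier G" for h g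
  proof -
    have "finite {z \<in> carrier H. (\<lambda>z\<in>carrier H. if z = h then g else \<one>\<^bsub>G\<^esub>) z \<noteq> \<one>\<^bsub>G\<^esub>}"
      by (rule finite_subset[of _ "{h}"]) auto
    with that show ?thesis by (auto simp: lamp_def PiE_iff simp del: restrict_apply simp add: restrict_apply')
  qed
  have pos_in: "pos x \<in> carrier (G \<wr> H)" if "x \<in> carrier H" for x
  proof -
    have "finite {z \<in> carrier H. (\<lambda>z\<in>carrier H. \<one>\<^bsub>G\<^esub>) z \<noteq> \<one>\<^bsub>G\<^esub>}"
      by (rule finite_subset[of _ "{}"]) auto
    with that show ?thesis by (simp add: pos_def PiE_iff restrict_apply' del: restrict_apply)
  qed
  interpret lamp: group_hom G "G \<wr> H" "lamp \<one>\<^bsub>H\<^esub>"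
    by unfold_locales (auto simp: hom_def lamp_in, auto simp: lamp_def intro!: restrict_ext)
  interpret pos: group_hom H "G \<wr> H" pos
    by unfold_locales (auto simp: hom_def pos_in, auto simp: pos_def intro!: restrict_ext)
  define U where "U = lamp \<one>\<^bsub>H\<^esub> ` S \<union> pos ` T"
  have S': "finite S" "S \<subseteq> carrier G" "\<forall>s\<in>S. inv\<^bsub>G\<^esub> s \<in> S" "generate G S = carrier G"
    and T': "finite T" "T \<subseteq> carrier H" "\<forall>s\<in>T. inv\<^bsub>H\<^esub> s \<in> T" "generate H T = carrier H"
    using S T by (auto simp: finite_symmetric_generating_set_def)
  have U: "finite U" "U \<subseteq> carrier (G \<wr> H)" "\<forall>u\<in>U. inv\<^bsub>G \<wr> H\<^esub> u \<in> U"
    using S' T'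
    by (auto simp: U_def lamp_in pos_in subset_iff
        simp flip: lamp.hom_inv pos.hom_inv simp del: wreath_simps)
  have gen1: "lamp \<one>\<^bsub>H\<^esub> g \<in> generate (G \<wr> H) U" if "g \<in> carrier G" for g
  proof -
    have "lamp \<one>\<^bsub>H\<^esub> g \<in> generate (G \<wr> H) (lamp \<one>\<^bsub>H\<^esub> ` S)"
      using that lamp.generate_img[OF S'(2)] S'(4) by simp
    then show ?thesis using W.mono_generate[of "lamp \<one>\<^bsub>H\<^esub> ` S" U] by (auto simp: U_def)
  qed
  have gen2: "pos x \<in> generate (G \<wr> H) U" if "x \<in> carrier H" for x
  proof -
    have "pos x \<in> generate (G \<wr> H) (pos ` T)"
      using that pos.generate_img[OF T'(2)] T'(4) by simp
    then show ?thesis using W.mono_generate[of "pos ` T" U] by (auto simp: U_def)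
  qed
  have gen3: "lamp h g \<in> generate (G \<wr> H) U" if "g \<in> carrier G" "h \<in> carrier H" for h g
  proof -
    have eq: "inv\<^bsub>H\<^esub> h \<otimes>\<^bsub>H\<^esub> z = \<one>\<^bsub>H\<^esub> \<longleftrightarrow> z = h" if "z \<in> carrier H" for z
      using that \<open>h \<in> carrier H\<close> by (metis H.inv_equality H.inv_inv H.inv_closed H.l_inv)
    have "lamp h g = pos h \<otimes>\<^bsub>G \<wr> H\<^esub> lamp \<one>\<^bsub>H\<^esub> g \<otimes>\<^bsub>G \<wr> H\<^esub> pos (inv\<^bsub>H\<^esub> h)"
      using that by (auto simp: lamp_def pos_def eq intro!: restrict_ext)
    moreover have "\<dots> \<in> generate (G \<wr> H) U"
      using that by (intro generate.eng gen1 gen2) auto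
    ultimately show ?thesis by simp
  qed
  have gen4: "(f, \<one>\<^bsub>H\<^esub>) \<in> generate (G \<wr> H) U"
    if "finite F" "f \<in> carrier H \<rightarrow>\<^sub>E carrier G" "{z \<in> carrier H. f z \<noteq> \<one>\<^bsub>G\<^esub>} \<subseteq> F" for f F
    using that
  proof (induction F arbitrary: f)
    case empty
    then have "f = (\<lambda>z\<in>carrier H. \<one>\<^bsub>G\<^esub>)" by (auto simp: PiE_iff extensional_def fun_eq_iff)
    then show ?case using generate.one[of "G \<wr> H" U] by (simp del: restrict_apply)
  next
    case (insert a F)
    show ?case
    proof (cases "a \<in> carrier H")
      case False
      with insert.prems have "{z \<in> carrier H. f z \<noteq> \<one>\<^bsub>G\<^esub>} \<subseteq> F" by auto
      with insert.prems(1) show ?thesis by (rule insert.IH)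
    next
      case True
      define g where "g = (\<lambda>z\<in>carrier H. if z = a then \<one>\<^bsub>G\<^esub> else f z)"
      have "(g, \<one>\<^bsub>H\<^esub>) \<in> generate (G \<wr> H) U"
        using insert.prems by (intro insert.IH) (auto simp: g_def PiE_iff extensional_def)
      moreover have "(f, \<one>\<^bsub>H\<^esub>) = lamp a (f a) \<otimes>\<^bsub>G \<wr> H\<^esub> (g, \<one>\<^bsub>H\<^esub>)"
      proof -
        have "(\<lambda>z\<in>carrier H. (\<lambda>z\<in>carrier H. if z = a then f a else \<one>\<^bsub>G\<^esub>) z \<otimes>\<^bsub>G\<^esub> g (inv\<^bsub>H\<^esub> \<one>\<^bsub>H\<^esub> \<otimes>\<^bsub>H\<^esub> z))
            = restrict f (carrier H)"
          using insert.prems(1) by (intro restrict_ext) (auto simp: g_def PiE_iff)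
        moreover have "\<dots> = f"
          using insert.prems(1) by (simp add: PiE_restrict)
        ultimately show ?thesis by (simp add: lamp_def del: restrict_apply)
      qed
      moreover have "lamp a (f a) \<in> generate (G \<wr> H) U"
        using insert.prems(1) True by (intro gen3) auto
      ultimately show ?thesis
        using generate.eng[of "lamp a (f a)" "G \<wr> H" U "(g, \<one>\<^bsub>H\<^esub>)"] by (simp only:)
    qed
  qed
  have "p \<in> generate (G \<wr> H) U" if p: "p \<in> carrier (G \<wr> H)" for p
  proof -
    obtain f x where px: "p = (f, x)" by (cases p)
    with p have f: "f \<in> carrier H \<rightarrow>\<^sub>E carrier G" "finite {z \<in> carrier H. f z \<noteq> \<one>\<^bsub>G\<^esub>}" "x \<in> carrier H"
      by auto
    have "p = (f, \<one>\<^bsub>H\<^esub>) \<otimes>\<^bsub>G \<wr> H\<^esub> pos x"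
    proof -
      have "(\<lambda>z\<in>carrier H. f z \<otimes>\<^bsub>G\<^esub> (\<lambda>z\<in>carrier H. \<one>\<^bsub>G\<^esub>) (inv\<^bsub>H\<^esub> \<one>\<^bsub>H\<^esub> \<otimes>\<^bsub>H\<^esub> z))
          = restrict f (carrier H)"
        using f(1) by (intro restrict_ext) (auto simp: PiE_iff)
      moreover have "\<dots> = f"
        using f(1) by (simp add: PiE_restrict)
      ultimately show ?thesis using f(3) by (simp add: px pos_def del: restrict_apply)
    qed
    moreover have "(f, \<one>\<^bsub>H\<^esub>) \<in> generate (G \<wr> H) U"
      using f by (intro gen4[OF f(2)]) auto
    ultimately show ?thesis
      using generate.eng[of "(f, \<one>\<^bsub>H\<^esub>)" "G \<wr> H" U "pos x"] gen2[OF f(3)] by (simp only:)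
  qed
  then have "generate (G \<wr> H) U = carrier (G \<wr> H)"
    using W.generate_incl[OF U(2)] by (intro equalityI subsetI) auto
  with U show ?thesis
    by (intro exI[of _ U]) (simp add: finite_symmetric_generating_set_def)
qed

end

theory Submission
  imports Defs
begin

text \<open>
  Fix a map \<open>\<psi>\<close> of \<open>G\<close> into Hilbert space that realises the exponent \<open>\<alpha>\<close>.  A configuration
  \<open>(f, x)\<close> of \<open>G \<wr> \<int>\<close> consists of lamps \<open>f\<close> and a position \<open>x\<close>.  Up to constants, the distance
  from \<open>(f, x)\<close> to \<open>(g, y)\<close> is \<open>D + M\<close>, where \<open>D\<close> is the sum of the distances in \<open>G\<close> between \<open>f z\<close>
  and \<open>g z\<close>, and \<open>M\<close> is the largest of \<open>\<bar>x - y\<bar>\<close> and the numbers \<open>\<bar>z - x\<bar>\<close> with \<open>f z \<noteq> g z\<close>: one walks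
  over all sites that differ and corrects each of them (\<open>word_dist_upper_bound\<close>).

  The embedding is a direct sum.  One summand applies \<open>\<psi>\<close> to every lamp; the squared distance is at
  least a constant times the sum of the \<open>d\<^sub>z powr (2 * \<alpha>)\<close>, \<open>d\<^sub>z\<close> being the distance in \<open>G\<close> at the
  site \<open>z\<close>.  The others see \<open>M\<close> only.  For each \<open>k\<close> to the right of \<open>x\<close> take the basis vector indexed
  by \<open>k\<close> and by the restriction of \<open>f\<close> to \<open>{k..}\<close>, with coefficient \<open>(k - x) powr \<beta>\<close>; do the same on
  the left, and add the coordinate \<open>x\<close> itself.  The lamp at \<open>x\<close> influences no vector with a nonzero
  coefficient, and a step of \<open>x\<close> changes the coefficients by a square-summable amount because
  \<open>\<beta> < 1/2\<close>.  So the map is Lipschitz.  If \<open>f\<close> and \<open>g\<close> differ at distance \<open>M\<close> to the right of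
  \<open>x\<close> and \<open>y\<close> is not far from \<open>x\<close> compared with \<open>M\<close>, about \<open>M\<close> basis vectors differ, and the squared
  distance is at least of order \<open>M powr (2 * \<beta> + 1)\<close>; here \<open>2 * \<beta> + 1\<close> may be as close to \<open>2\<close> as desired.

  At most \<open>2 * M + 1\<close> sites differ.  If \<open>\<alpha> \<le> 1/2\<close>, the sum of the \<open>d\<^sub>z powr (2 * \<alpha>)\<close> is at least
  \<open>D powr (2 * \<alpha>)\<close>.  If \<open>\<alpha> > 1/2\<close>, the power mean inequality gives at least
  \<open>(2 * M + 1) powr (1 - 2 * \<alpha>) * D powr (2 * \<alpha>)\<close>, and this balances \<open>M\<^sup>2\<close> at \<open>M = D powr e\<close> with
  \<open>e = 2 * \<alpha> / (2 * \<alpha> + 1)\<close>.  Hence every exponent below \<open>\<alpha>\<close>, respectively below \<open>e\<close>, is attained on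
  \<open>G \<wr> \<int>\<close> (\<open>wreath_compression_exponent\<close>).  Conversely \<open>G\<close> sits in \<open>G \<wr> \<int>\<close> as the group of values of
  one lamp, with comparable metrics, so every exponent of \<open>G \<wr> \<int>\<close> is an exponent of \<open>G\<close>
  (\<open>compression_exponents_subset\<close>).
\<close>

section \<open>Squared distances in \<open>L\<^sub>2\<close>\<close>

lemma L2_diff:
  assumes "u \<in> L2" "v \<in> L2"
  shows "(\<lambda>t. u t - v t) \<in> L2"
proof -
  let ?M = "lebesgue_on {0..1::real}"
  have [measurable]: "u \<in> borel_measurable ?M" "v \<in> borel_measurable ?M"
    using assms by (auto simp: L2_def)
  have int: "integrable ?M (\<lambda>t. 2 * (u t)\<^sup>2 + 2 * (v t)\<^sup>2)"
    using assms by (auto simp: L2_def)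
  have bound: "(a - b)\<^sup>2 \<le> 2 * a\<^sup>2 + 2 * b\<^sup>2" for a b :: real
    using zero_le_power2[of "a + b"] by (simp add: power2_eq_square algebra_simps)
  have "integrable ?M (\<lambda>t. (u t - v t)\<^sup>2)"
    by (rule Bochner_Integration.integrable_bound[OF int]) (use bound in \<open>auto intro!: AE_I2\<close>)
  then show ?thesis by (simp add: L2_def)
qed

lemma L2_dist_square: "(L2_dist u v)\<^sup>2 = (\<integral>t. (u t - v t)\<^sup>2 \<partial>lebesgue_on {0..1})"
  by (simp add: L2_dist_def)

lemma L2_dist_nonneg [simp]: "0 \<le> L2_dist u v"
  by (simp add: L2_dist_def)

lemma L2_dist_refl [simp]: "L2_dist u u = 0"
  by (simp add: L2_dist_def)

lemma L2_dist_commute: "L2_dist u v = L2_dist v u"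
  by (simp add: L2_dist_def power2_commute)

text \<open>
  For \<open>a, b > 0\<close> the pointwise bound \<open>(x + y)\<^sup>2 \<le> (1 + b / a) * x\<^sup>2 + (1 + a / b) * y\<^sup>2\<close> can be
  integrated.  If \<open>a\<close> and \<open>b\<close> are slightly larger than the two distances on the right, so that neither
  vanishes, the integral is at most \<open>(a + b)\<^sup>2\<close>.
\<close>

lemma L2_dist_triangle:
  assumes "u \<in> L2" "v \<in> L2" "w \<in> L2"
  shows "L2_dist u w \<le> L2_dist u v + L2_dist v w"
proof (rule field_le_epsilon)
  fix e :: real assume "0 < e"
  let ?M = "lebesgue_on {0..1::real}"
  define a where "a = L2_dist u v + e / 2"
  define b where "b = L2_dist v w + e / 2"
  have pos: "0 < a" "0 < b" using \<open>0 < e\<close> by (auto simp: a_def b_def add_nonneg_pos)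
  have int: "integrable ?M (\<lambda>t. (u t - v t)\<^sup>2)" "integrable ?M (\<lambda>t. (v t - w t)\<^sup>2)"
      "integrable ?M (\<lambda>t. (u t - w t)\<^sup>2)"
    using L2_diff[OF assms(1,2)] L2_diff[OF assms(2,3)] L2_diff[OF assms(1,3)] by (auto simp: L2_def)
  have pointwise: "(x + y)\<^sup>2 \<le> (1 + b / a) * x\<^sup>2 + (1 + a / b) * y\<^sup>2" for x y :: real
  proof -
    have "0 \<le> (b * x - a * y)\<^sup>2 / (a * b)" using pos by simp
    also have "\<dots> = (1 + b / a) * x\<^sup>2 + (1 + a / b) * y\<^sup>2 - (x + y)\<^sup>2"
      using pos by (simp add: field_simps power2_eq_square)
    finally show ?thesis by simp
  qed
  have "(L2_dist u w)\<^sup>2 \<le> (\<integral>t. (1 + b / a) * (u t - v t)\<^sup>2 + (1 + a / b) * (v t - w t)\<^sup>2 \<partial>?M)"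
    unfolding L2_dist_square using int pointwise[of "u t - v t" "v t - w t" for t]
    by (intro integral_mono) auto
  also have "\<dots> = (1 + b / a) * (L2_dist u v)\<^sup>2 + (1 + a / b) * (L2_dist v w)\<^sup>2"
    unfolding L2_dist_square using int by simp
  also have "\<dots> \<le> (1 + b / a) * a\<^sup>2 + (1 + a / b) * b\<^sup>2"
    using pos \<open>0 < e\<close> by (intro add_mono mult_left_mono power_mono) (auto simp: a_def b_def)
  also have "(1 + b / a) * a\<^sup>2 = a\<^sup>2 + a * b"
    using pos by (simp add: distrib_right power2_eq_square)
  also have "(1 + a / b) * b\<^sup>2 = b\<^sup>2 + a * b"
    using pos by (simp add: distrib_right power2_eq_square)
  also have "a\<^sup>2 + a * b + (b\<^sup>2 + a * b) = (a + b)\<^sup>2"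
    by (simp add: power2_sum)
  finally have "L2_dist u w \<le> a + b"
    by (rule power2_le_imp_le) (use pos in auto)
  then show "L2_dist u w \<le> L2_dist u v + L2_dist v w + e" by (simp add: a_def b_def)
qed

text \<open>
  The isometric dilation of \<open>L\<^sub>2\<close> over \<open>{0..1}\<close> onto \<open>L\<^sub>2\<close> over \<open>{1/c..2/c}\<close>.  The dilations with
  \<open>c = 2, 8, 32, \<dots>\<close> have disjoint supports, which makes room for countable direct sums inside \<open>L\<^sub>2\<close>
  over the unit interval.
\<close>

definition rescale :: "real \<Rightarrow> (real \<Rightarrow> real) \<Rightarrow> real \<Rightarrow> real" where
  "rescale c u = (\<lambda>t. if c * t - 1 \<in> {0..1} then sqrt c * u (c * t - 1) else 0)"

lemma rescale_isometry:
  assumes "u \<in> L2" "2 \<le> c"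
  shows "rescale c u \<in> L2"
    and "(\<integral>t. (rescale c u t)\<^sup>2 \<partial>lebesgue_on {0..1}) = (\<integral>t. (u t)\<^sup>2 \<partial>lebesgue_on {0..1})"
proof -
  \<comment> \<open>Extending \<open>u\<close> by \<open>0\<close> allows the affine change of variables on the whole line.\<close>
  define h where "h = (\<lambda>t. if t \<in> {0..1} then u t else 0)"
  have h: "h \<in> borel_measurable lebesgue"
    using assms(1) unfolding h_def L2_def by (subst borel_measurable_if) auto
  have "(\<lambda>t. -1 + (\<Sum>j\<in>Basis. (c * (t \<bullet> j)) *\<^sub>R j)) \<in> lebesgue \<rightarrow>\<^sub>M (lebesgue :: real measure)"
    using assms(2) by (intro lebesgue_affine_measurable) auto
  then have aff: "(\<lambda>t. c * t - 1) \<in> lebesgue \<rightarrow>\<^sub>M (lebesgue :: real measure)"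
    by (simp add: algebra_simps)
  have r: "rescale c u = (\<lambda>t. sqrt c * h (c * t - 1))"
    by (auto simp: rescale_def h_def)
  have meas: "rescale c u \<in> borel_measurable lebesgue"
    unfolding r using measurable_compose[OF aff h] by measurable
  have "integrable lebesgue (\<lambda>t. indicator {0..1} t *\<^sub>R (u t)\<^sup>2)"
    using assms(1) by (auto simp: L2_def integrable_restrict_space)
  moreover have ind: "(\<lambda>t. indicator {0..1} t *\<^sub>R (u t)\<^sup>2) = (\<lambda>t. (h t)\<^sup>2)"
    by (auto simp: h_def indicator_def)
  ultimately have "has_bochner_integral lebesgue (\<lambda>t. (h t)\<^sup>2) (\<integral>t. (u t)\<^sup>2 \<partial>lebesgue_on {0..1})"
    by (simp add: has_bochner_integral_iff integral_restrict_space)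
  then have "has_bochner_integral lebesgue (\<lambda>t. (h (-1 + c * t))\<^sup>2)
      ((\<integral>t. (u t)\<^sup>2 \<partial>lebesgue_on {0..1}) /\<^sub>R \<bar>c\<bar>)"
    using assms(2) has_bochner_integral_lebesgue_real_affine_iff[of c "\<lambda>t. (h t)\<^sup>2" _ "-1"] by simp
  from has_bochner_integral_mult_right[OF this, of c]
  have main: "has_bochner_integral lebesgue (\<lambda>t. (rescale c u t)\<^sup>2) (\<integral>t. (u t)\<^sup>2 \<partial>lebesgue_on {0..1})"
    using assms(2) by (simp add: r power_mult_distrib flip: mult.assoc)
  have "t \<in> {0..1}" if "c * t - 1 \<in> {0..1}" for t
  proof -
    have "0 \<le> c * t" "c * t \<le> c * 1" using that assms(2) by (simp_all only: atLeastAtMost_iff mult_1_right) linarith+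
    moreover have "0 < c" using assms(2) by simp
    ultimately show ?thesis by (auto simp only: zero_le_mult_iff mult_le_cancel_left_pos atLeastAtMost_iff)
  qed
  then have ind2: "(\<lambda>t. indicator {0..1} t *\<^sub>R (rescale c u t)\<^sup>2) = (\<lambda>t. (rescale c u t)\<^sup>2)"
    by (auto simp: rescale_def indicator_def)
  show "(\<integral>t. (rescale c u t)\<^sup>2 \<partial>lebesgue_on {0..1}) = (\<integral>t. (u t)\<^sup>2 \<partial>lebesgue_on {0..1})"
    using main by (subst integral_restrict_space) (simp_all only: ind2 has_bochner_integral_iff, auto)
  have "integrable (lebesgue_on {0..1}) (\<lambda>t. (rescale c u t)\<^sup>2)"
    using main by (subst integrable_restrict_space) (simp_all only: ind2 has_bochner_integral_iff, auto)
  then show "rescale c u \<in> L2"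
    using measurable_restrict_space1[OF meas] by (simp add: L2_def)
qed

lemma rescale_diff: "rescale c (\<lambda>t. u t - v t) t = rescale c u t - rescale c v t"
  by (simp add: rescale_def algebra_simps)

abbreviation dyadic_scale :: "nat \<Rightarrow> real" where "dyadic_scale n \<equiv> 2 * 4 ^ n"

text \<open>
  The intervals \<open>{1/c..2/c}\<close> for \<open>c = 2 * 4 ^ n\<close> are disjoint even with their end points, since
  consecutive values of \<open>c\<close> differ by a factor \<open>4 > 2\<close>.
\<close>

lemma rescale_dyadic_disjoint:
  assumes "m \<noteq> n"
  shows "rescale (dyadic_scale m) u t * rescale (dyadic_scale n) v t = 0"
proof -
  have *: "\<not> (dyadic_scale j * t - 1 \<in> {0..1} \<and> dyadic_scale i * t - 1 \<in> {0..1})" if "i < j" for i j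
  proof
    assume a: "dyadic_scale j * t - 1 \<in> {0..1} \<and> dyadic_scale i * t - 1 \<in> {0..1}"
    have "(4::real) ^ Suc i \<le> 4 ^ j" using that by (intro power_increasing) auto
    moreover have "0 < t"
    proof -
      have "1 \<le> dyadic_scale i * t" using a by auto
      then have "0 < dyadic_scale i * t" by linarith
      then show ?thesis by (simp add: zero_less_mult_iff)
    qed
    ultimately have "4 ^ Suc i * t \<le> 4 ^ j * t"
      by (intro mult_right_mono) auto
    then have "4 * (4 ^ i * t) \<le> 4 ^ j * t" by simp
    then show False using a by auto
  qed
  show ?thesis using assms *[of m n] *[of n m] by (cases m n rule: linorder_cases) (auto simp: rescale_def)
qed

lemma square_sum_orthogonal:
  fixes f :: "'i \<Rightarrow> real"
  assumes "finite A" "\<And>i j. i \<in> A \<Longrightarrow> j \<in> A \<Longrightarrow> i \<noteq> j \<Longrightarrow> f i * f j = 0"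
  shows "(\<Sum>i\<in>A. f i)\<^sup>2 = (\<Sum>i\<in>A. (f i)\<^sup>2)"
proof -
  have "(\<Sum>j\<in>A. f i * f j) = (f i)\<^sup>2" if "i \<in> A" for i
  proof -
    have "(\<Sum>j\<in>A. f i * f j) = (\<Sum>j\<in>A. if j = i then (f i)\<^sup>2 else 0)"
      using assms(2) that by (intro sum.cong) (auto simp: power2_eq_square)
    then show ?thesis using assms(1) that by simp
  qed
  then show ?thesis by (simp add: power2_eq_square sum_product)
qed

definition dyadic_sum :: "('i \<Rightarrow> nat) \<Rightarrow> 'i set \<Rightarrow> ('i \<Rightarrow> real \<Rightarrow> real) \<Rightarrow> real \<Rightarrow> real" where
  "dyadic_sum e A u = (\<lambda>t. \<Sum>i\<in>A. rescale (dyadic_scale (e i)) (u i) t)"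

lemma dyadic_sum_L2:
  assumes A: "finite A" "inj_on e A" and u: "\<And>i. i \<in> A \<Longrightarrow> u i \<in> L2"
  shows "dyadic_sum e A u \<in> L2"
    and "(\<integral>t. (dyadic_sum e A u t)\<^sup>2 \<partial>lebesgue_on {0..1})
       = (\<Sum>i\<in>A. \<integral>t. (u i t)\<^sup>2 \<partial>lebesgue_on {0..1})"
proof -
  let ?r = "\<lambda>i. rescale (dyadic_scale (e i)) (u i)"
  have sc: "2 \<le> dyadic_scale n" for n by simp
  have r: "?r i \<in> L2" if "i \<in> A" for i using rescale_isometry(1)[OF u[OF that] sc] .
  have sq: "(\<lambda>t. (dyadic_sum e A u t)\<^sup>2) = (\<lambda>t. \<Sum>i\<in>A. (?r i t)\<^sup>2)"
    unfolding dyadic_sum_def using A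
    by (intro ext square_sum_orthogonal rescale_dyadic_disjoint) (auto simp: inj_on_def)
  show "dyadic_sum e A u \<in> L2"
    using r unfolding L2_def mem_Collect_eq sq
    by (auto simp: dyadic_sum_def intro!: borel_measurable_sum)
  show "(\<integral>t. (dyadic_sum e A u t)\<^sup>2 \<partial>lebesgue_on {0..1})
       = (\<Sum>i\<in>A. \<integral>t. (u i t)\<^sup>2 \<partial>lebesgue_on {0..1})"
    unfolding sq using r rescale_isometry(2)[OF u sc]
    by (subst Bochner_Integration.integral_sum) (auto simp: L2_def)
qed

text \<open>
  A kernel of this kind is the square of the distance pulled back from \<open>L\<^sub>2\<close>, that is, a conditionally
  negative definite kernel on \<open>V\<close> (for countable \<open>V\<close>).  Direct sums of maps become sums of kernels, so
  that after the closure properties below no function in \<open>L\<^sub>2\<close> has to be written down again.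
\<close>

definition hilbert_kernel :: "'x set \<Rightarrow> ('x \<Rightarrow> 'x \<Rightarrow> real) \<Rightarrow> bool" where
  "hilbert_kernel V q \<longleftrightarrow> (\<exists>F. F \<in> V \<rightarrow> L2 \<and> (\<forall>x\<in>V. \<forall>y\<in>V. q x y = (L2_dist (F x) (F y))\<^sup>2))"

lemma hilbert_kernel_nonneg: "hilbert_kernel V q \<Longrightarrow> x \<in> V \<Longrightarrow> y \<in> V \<Longrightarrow> 0 \<le> q x y"
  by (auto simp: hilbert_kernel_def)

lemma hilbert_kernel_refl: "hilbert_kernel V q \<Longrightarrow> x \<in> V \<Longrightarrow> q x x = 0"
  by (auto simp: hilbert_kernel_def)

lemma hilbert_kernel_commute: "hilbert_kernel V q \<Longrightarrow> x \<in> V \<Longrightarrow> y \<in> V \<Longrightarrow> q x y = q y x"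
  by (auto simp: hilbert_kernel_def L2_dist_commute)

lemma hilbert_kernel_triangle:
  assumes "hilbert_kernel V q" "x \<in> V" "y \<in> V" "z \<in> V"
  shows "sqrt (q x z) \<le> sqrt (q x y) + sqrt (q y z)"
proof -
  obtain F where F: "F \<in> V \<rightarrow> L2" "\<forall>x\<in>V. \<forall>y\<in>V. q x y = (L2_dist (F x) (F y))\<^sup>2"
    using assms(1) by (auto simp: hilbert_kernel_def)
  have "sqrt (q a b) = L2_dist (F a) (F b)" if "a \<in> V" "b \<in> V" for a b
    using that F(2) by simp
  then have "sqrt (q x y) = L2_dist (F x) (F y)" "sqrt (q y z) = L2_dist (F y) (F z)"
      "sqrt (q x z) = L2_dist (F x) (F z)"
    using assms(2-) by blast+
  moreover have "F x \<in> L2" "F y \<in> L2" "F z \<in> L2" using F(1) assms(2-) by auto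
  then have "L2_dist (F x) (F z) \<le> L2_dist (F x) (F y) + L2_dist (F y) (F z)"
    by (rule L2_dist_triangle)
  ultimately show ?thesis by (simp only:)
qed

lemma hilbert_kernel_comp:
  assumes "hilbert_kernel Y q" "h \<in> V \<rightarrow> Y"
  shows "hilbert_kernel V (\<lambda>x y. q (h x) (h y))"
proof -
  obtain F where "F \<in> Y \<rightarrow> L2" "\<forall>x\<in>Y. \<forall>y\<in>Y. q x y = (L2_dist (F x) (F y))\<^sup>2"
    using assms(1) by (auto simp: hilbert_kernel_def)
  then show ?thesis
    using assms(2) unfolding hilbert_kernel_def by (intro exI[of _ "F \<circ> h"]) (auto simp: Pi_iff)
qed

lemma hilbert_kernel_real: "hilbert_kernel V (\<lambda>x y. (a x - a y)\<^sup>2)"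
proof -
  have "(\<lambda>t. a x) \<in> L2" for x
    by (simp add: L2_def finite_measure.integrable_const finite_measure_lebesgue_on)
  moreover have "(a x - a y)\<^sup>2 = (L2_dist (\<lambda>t. a x) (\<lambda>t. a y))\<^sup>2" for x y
    unfolding L2_dist_square by (simp add: measure_restrict_space)
  ultimately show ?thesis
    unfolding hilbert_kernel_def by (intro exI[of _ "\<lambda>x t. a x"]) auto
qed

lemma hilbert_kernel_zero_sets:
  assumes q: "hilbert_kernel V q" and V: "x \<in> V" "y \<in> V" "z \<in> V" and "q z x = 0" "q z y = 0"
  shows "q x y = 0"
  using hilbert_kernel_triangle[OF q V(1) V(3) V(2)] hilbert_kernel_commute[OF q V(1) V(3)]
    hilbert_kernel_nonneg[OF q V(1,2)] assms(5,6)
  by simp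

text \<open>
  The direct sum of a family of maps that, seen from the base point \<open>z\<close>, has finite support at every
  point.  Only countably many indices matter, because \<open>V\<close> is countable; they are numbered by \<open>e\<close> and
  placed on disjoint intervals.  Translating every map by its value at \<open>z\<close> makes the sums finite.
\<close>

lemma hilbert_kernel_sum:
  fixes q :: "'i \<Rightarrow> 'x \<Rightarrow> 'x \<Rightarrow> real"
  assumes V: "countable V" "z \<in> V"
    and q: "\<And>i. hilbert_kernel V (q i)"
    and fin: "\<And>x. x \<in> V \<Longrightarrow> finite {i. q i z x \<noteq> 0}"
  shows "hilbert_kernel V (\<lambda>x y. \<Sum>i | q i x y \<noteq> 0. q i x y)"
proof -
  define S where "S x = {i. q i z x \<noteq> 0}" for x
  define e where "e = to_nat_on (\<Union>x\<in>V. S x)"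
  have "countable (\<Union>x\<in>V. S x)"
    using V(1) fin by (intro countable_UN) (auto simp: S_def countable_finite)
  then have inj: "inj_on e (\<Union>x\<in>V. S x)" by (simp only: e_def inj_on_to_nat_on)
  have "\<forall>i. \<exists>F. F \<in> V \<rightarrow> L2 \<and> (\<forall>x\<in>V. \<forall>y\<in>V. q i x y = (L2_dist (F x) (F y))\<^sup>2)"
    using q by (auto simp: hilbert_kernel_def)
  then obtain F where F: "\<And>i. F i \<in> V \<rightarrow> L2"
      "\<And>i x y. x \<in> V \<Longrightarrow> y \<in> V \<Longrightarrow> q i x y = (L2_dist (F i x) (F i y))\<^sup>2"
    by metis
  define P where "P i x = (if i \<in> S x then F i x else F i z)" for i x
  define U where "U i x = (\<lambda>t. P i x t - F i z t)" for i x
  have P: "P i x \<in> L2" if "x \<in> V" for i x using that F(1) V(2) by (auto simp: P_def)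
  have U: "U i x \<in> L2" if "x \<in> V" for i x
    unfolding U_def using P[OF that] F(1) V(2) by (intro L2_diff) auto
  have PF: "L2_dist (P i x) (F i x) = 0" if "x \<in> V" for i x
    using that F(2)[OF V(2) that, of i] by (auto simp: P_def S_def)
  \<comment> \<open>Moving the points at distance \<open>0\<close> from the base point to the base point changes no distance.\<close>
  have dist: "L2_dist (P i x) (P i y) = L2_dist (F i x) (F i y)" if "x \<in> V" "y \<in> V" for i x y
  proof -
    have "F i x \<in> L2" "F i y \<in> L2" "P i x \<in> L2" "P i y \<in> L2" using F(1) P that by auto
    then show ?thesis
      using PF[OF that(1), of i] PF[OF that(2), of i] L2_dist_commute[of "P i x" "F i x"]
        L2_dist_commute[of "P i y" "F i y"] L2_dist_triangle[of "P i x" "F i x" "P i y"]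
        L2_dist_triangle[of "F i x" "F i y" "P i y"] L2_dist_triangle[of "F i x" "P i x" "F i y"]
        L2_dist_triangle[of "P i x" "P i y" "F i y"] by linarith
  qed
  define H where "H x = dyadic_sum e (S x) (\<lambda>i. U i x)" for x
  have "H x \<in> L2" if "x \<in> V" for x
    unfolding H_def using that U inj fin by (intro dyadic_sum_L2) (auto simp: S_def inj_on_def)
  moreover have "(\<Sum>i | q i x y \<noteq> 0. q i x y) = (L2_dist (H x) (H y))\<^sup>2" if xy: "x \<in> V" "y \<in> V" for x y
  proof -
    let ?J = "S x \<union> S y"
    have J: "finite ?J" "inj_on e ?J" using fin xy inj by (auto simp: S_def inj_on_def)
    have U0: "U i w = (\<lambda>t. 0)" if "i \<notin> S w" for i w using that by (simp add: U_def P_def)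
    have ext: "H w = dyadic_sum e ?J (\<lambda>i. U i w)" if "w = x \<or> w = y" for w
      unfolding H_def dyadic_sum_def using J(1) that
      by (intro ext sum.mono_neutral_left) (auto simp: U0 rescale_def)
    have "H x t - H y t = dyadic_sum e ?J (\<lambda>i t. U i x t - U i y t) t" for t
      by (simp add: ext dyadic_sum_def rescale_diff sum_subtractf)
    then have "(L2_dist (H x) (H y))\<^sup>2 = (\<Sum>i\<in>?J. \<integral>t. (U i x t - U i y t)\<^sup>2 \<partial>lebesgue_on {0..1})"
      unfolding L2_dist_square using J U xy by (simp add: dyadic_sum_L2(2) L2_diff)
    also have "\<dots> = (\<Sum>i\<in>?J. q i x y)"
      using dist[OF xy] F(2)[OF xy] by (simp add: U_def flip: L2_dist_square)
    also have "\<dots> = (\<Sum>i | q i x y \<noteq> 0. q i x y)"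
      using hilbert_kernel_zero_sets[OF q xy V(2)] J(1)
      by (intro sum.mono_neutral_right) (auto simp: S_def)
    finally show ?thesis ..
  qed
  ultimately show ?thesis unfolding hilbert_kernel_def by (intro exI[of _ H]) auto
qed

lemma hilbert_kernel_add:
  assumes "countable V" "hilbert_kernel V p" "hilbert_kernel V q"
  shows "hilbert_kernel V (\<lambda>x y. p x y + q x y)"
proof (cases "V = {}")
  case True
  then show ?thesis by (simp add: hilbert_kernel_def)
next
  case False
  define r where "r b = (if b then p else q)" for b
  have "(\<Sum>b | r b x y \<noteq> 0. r b x y) = (\<Sum>b\<in>UNIV. r b x y)" for x y
    by (intro sum.mono_neutral_left) auto
  then have "(\<Sum>b | r b x y \<noteq> 0. r b x y) = p x y + q x y" for x y
    by (simp add: UNIV_bool r_def)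
  moreover have "hilbert_kernel V (\<lambda>x y. \<Sum>b | r b x y \<noteq> 0. r b x y)"
    using False assms by (intro hilbert_kernel_sum[of V "SOME x. x \<in> V"]) (auto simp: r_def some_in_eq)
  ultimately show ?thesis by simp
qed

section \<open>Word metrics and compression exponents\<close>

locale word_metric = group G for G (structure) +
  fixes S
  assumes gen: "finite_symmetric_generating_set G S"
begin

abbreviation "wl \<equiv> word_length G S"
abbreviation "wd \<equiv> word_dist G S"
abbreviation "word_value w \<equiv> foldr (\<otimes>) w \<one>"

lemma generators: "finite S" "s \<in> S \<Longrightarrow> s \<in> carrier G" "s \<in> S \<Longrightarrow> inv s \<in> S" "generate G S = carrier G"
  using gen by (auto simp: finite_symmetric_generating_set_def)

lemma word_value_closed: "set w \<subseteq> S \<Longrightarrow> word_value w \<in> carrier G"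
  by (induction w) (auto simp: generators)

lemma word_value_append:
  "set v \<subseteq> S \<Longrightarrow> set w \<subseteq> S \<Longrightarrow> word_value (v @ w) = word_value v \<otimes> word_value w"
  by (induction v) (auto simp: generators word_value_closed m_assoc)

lemma word_exists:
  assumes "g \<in> carrier G"
  shows "\<exists>w. set w \<subseteq> S \<and> word_value w = g"
proof -
  from assms have "g \<in> generate G S" by (simp add: generators(4))
  then show ?thesis
  proof induction
    case one
    show ?case by (intro exI[of _ "[]"]) simp
  next
    case (incl h)
    then show ?case by (intro exI[of _ "[h]"]) (simp add: generators)
  next
    case (inv h)
    then show ?case by (intro exI[of _ "[inv h]"]) (simp add: generators)
  next
    case (eng g h)
    then obtain v w where "set v \<subseteq> S" "word_value v = g" "set w \<subseteq> S" "word_value w = h" by auto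
    then show ?case using word_value_append by (intro exI[of _ "v @ w"]) auto
  qed
qed

lemma shortest_word:
  assumes "g \<in> carrier G"
  obtains w where "set w \<subseteq> S" "length w = wl g" "word_value w = g"
proof -
  have "\<exists>n w. set w \<subseteq> S \<and> length w = n \<and> word_value w = g"
    using word_exists[OF assms] by auto
  from LeastI_ex[OF this] show ?thesis using that unfolding word_length_def by blast
qed

lemma word_length_le: "set w \<subseteq> S \<Longrightarrow> word_value w = g \<Longrightarrow> wl g \<le> length w"
  unfolding word_length_def by (rule Least_le) auto

lemma word_length_one [simp]: "wl \<one> = 0"
  using word_length_le[of "[]" \<one>] by simp

lemma word_length_eq_0: "g \<in> carrier G \<Longrightarrow> wl g = 0 \<longleftrightarrow> g = \<one>"
  using shortest_word[of g] by force

lemma word_length_mult: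
  assumes "g \<in> carrier G" "h \<in> carrier G"
  shows "wl (g \<otimes> h) \<le> wl g + wl h"
proof -
  obtain v w where "set v \<subseteq> S" "length v = wl g" "word_value v = g"
    "set w \<subseteq> S" "length w = wl h" "word_value w = h"
    using shortest_word assms by metis
  then show ?thesis using word_length_le[of "v @ w" "g \<otimes> h"] word_value_append[of v w] by simp
qed

lemma word_dist_mult: "g \<in> carrier G \<Longrightarrow> h \<in> carrier G \<Longrightarrow> wd g (g \<otimes> h) = wl h"
  by (simp add: word_dist_def flip: m_assoc)

lemma word_dist_refl [simp]: "g \<in> carrier G \<Longrightarrow> wd g g = 0"
  by (simp add: word_dist_def)

lemma word_dist_eq_0:
  assumes "g \<in> carrier G" "h \<in> carrier G"
  shows "wd g h = 0 \<longleftrightarrow> g = h"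
proof -
  have "inv g \<otimes> h = \<one> \<longleftrightarrow> g = h" using assms inv_equality[of "inv g" h] by auto
  then show ?thesis using assms by (simp add: word_dist_def word_length_eq_0)
qed

lemma word_dist_triangle:
  assumes "x \<in> carrier G" "y \<in> carrier G" "z \<in> carrier G"
  shows "wd x z \<le> wd x y + wd y z"
proof -
  have "y \<otimes> (inv y \<otimes> z) = z" using assms by (simp flip: m_assoc)
  then have "inv x \<otimes> z = (inv x \<otimes> y) \<otimes> (inv y \<otimes> z)" using assms by (simp add: m_assoc)
  then show ?thesis using assms word_length_mult[of "inv x \<otimes> y" "inv y \<otimes> z"] by (simp add: word_dist_def)
qed

text \<open>
  It suffices to bound a pseudometric along the edges of the Cayley graph.  Besides Lipschitz
  estimates for maps into \<open>L\<^sub>2\<close>, this yields comparisons of word metrics, so that no particular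
  generating set ever has to be fixed.
\<close>

lemma lipschitz_from_generators:
  fixes d :: "'a \<Rightarrow> 'a \<Rightarrow> real"
  assumes tri: "\<And>x y z. x \<in> carrier G \<Longrightarrow> y \<in> carrier G \<Longrightarrow> z \<in> carrier G \<Longrightarrow> d x z \<le> d x y + d y z"
    and refl: "\<And>x. x \<in> carrier G \<Longrightarrow> d x x = 0"
    and step: "\<And>x s. x \<in> carrier G \<Longrightarrow> s \<in> S \<Longrightarrow> d x (x \<otimes> s) \<le> L"
    and xy: "x \<in> carrier G" "y \<in> carrier G"
  shows "d x y \<le> L * real (wd x y)"
proof -
  have word: "d u (u \<otimes> word_value w) \<le> L * real (length w)" if "set w \<subseteq> S" "u \<in> carrier G" for u w
    using that
  proof (induction w arbitrary: u)
    case Nil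
    then show ?case by (simp add: refl)
  next
    case (Cons s w)
    then have s: "s \<in> carrier G" "word_value w \<in> carrier G" by (auto simp: generators word_value_closed)
    have "d u (u \<otimes> (s \<otimes> word_value w)) \<le> d u (u \<otimes> s) + d (u \<otimes> s) (u \<otimes> s \<otimes> word_value w)"
      using tri[of u "u \<otimes> s" "u \<otimes> s \<otimes> word_value w"] Cons.prems s by (simp add: m_assoc)
    also have "\<dots> \<le> L + L * real (length w)"
      using Cons s by (intro add_mono step Cons.IH) auto
    finally show ?case by (simp add: algebra_simps)
  qed
  obtain w where "set w \<subseteq> S" "length w = wl (inv x \<otimes> y)" "word_value w = inv x \<otimes> y"
    using shortest_word[of "inv x \<otimes> y"] xy by auto
  then show ?thesis using word[of w x] xy by (simp add: word_dist_def flip: m_assoc)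
qed

lemma countable_carrier: "countable (carrier G)"
proof -
  have "carrier G \<subseteq> word_value ` lists S" using word_exists by (force simp: lists_eq_set)
  moreover have "countable (lists S)" using generators(1) by (simp add: countable_finite)
  ultimately show ?thesis by (meson countable_subset countable_image)
qed

text \<open>
  Balls are finite.
\<close>

lemma word_length_unbounded:
  assumes "infinite (carrier G)"
  obtains g where "g \<in> carrier G" "n < wl g"
proof (rule ccontr)
  assume "\<not> thesis"
  with that have le: "wl g \<le> n" if "g \<in> carrier G" for g using that by force
  have "carrier G \<subseteq> word_value ` {w. set w \<subseteq> S \<and> length w \<le> n}"
  proof
    fix g assume g: "g \<in> carrier G"
    then obtain w where "set w \<subseteq> S" "length w = wl g" "word_value w = g" by (rule shortest_word)
    then show "g \<in> word_value ` {w. set w \<subseteq> S \<and> length w \<le> n}" using le[OF g] by auto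
  qed
  then have "finite (carrier G)"
    using finite_lists_length_le[OF generators(1), of n] by (meson finite_surj)
  then show False using assms by simp
qed

lemma compression_exponentI:
  assumes "0 \<le> \<alpha>" "0 < c" and q: "hilbert_kernel (carrier G) q"
    and "\<And>x y. x \<in> carrier G \<Longrightarrow> y \<in> carrier G \<Longrightarrow> sqrt (q x y) \<le> L * real (wd x y)"
    and "\<And>x y. x \<in> carrier G \<Longrightarrow> y \<in> carrier G \<Longrightarrow> x \<noteq> y \<Longrightarrow> c * real (wd x y) powr \<alpha> \<le> sqrt (q x y)"
  shows "\<alpha> \<in> compression_exponents G S"
proof -
  from q obtain f where f: "f \<in> carrier G \<rightarrow> L2"
      "\<forall>x\<in>carrier G. \<forall>y\<in>carrier G. q x y = (L2_dist (f x) (f y))\<^sup>2"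
    unfolding hilbert_kernel_def by auto
  have "sqrt (q x y) = L2_dist (f x) (f y)" if "x \<in> carrier G" "y \<in> carrier G" for x y
    using f(2) that by simp
  with assms f(1) have "f \<in> carrier G \<rightarrow> L2 \<and> 0 < c \<and>
      (\<forall>x\<in>carrier G. \<forall>y\<in>carrier G. L2_dist (f x) (f y) \<le> L * real (wd x y)) \<and>
      (\<forall>x\<in>carrier G. \<forall>y\<in>carrier G. x \<noteq> y \<longrightarrow> c * real (wd x y) powr \<alpha> \<le> L2_dist (f x) (f y))"
    by simp
  then have "\<exists>f L c. f \<in> carrier G \<rightarrow> L2 \<and> 0 < c \<and>
      (\<forall>x\<in>carrier G. \<forall>y\<in>carrier G. L2_dist (f x) (f y) \<le> L * real (wd x y)) \<and>
      (\<forall>x\<in>carrier G. \<forall>y\<in>carrier G. x \<noteq> y \<longrightarrow> c * real (wd x y) powr \<alpha> \<le> L2_dist (f x) (f y))"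
    by (intro exI)
  with assms(1) show ?thesis unfolding compression_exponents_def mem_Collect_eq by (rule conjI)
qed

lemma compression_exponentE:
  assumes "\<alpha> \<in> compression_exponents G S"
  obtains c q L where "0 \<le> \<alpha>" "0 < c" "hilbert_kernel (carrier G) q"
    "\<forall>x\<in>carrier G. \<forall>y\<in>carrier G. sqrt (q x y) \<le> L * real (wd x y)"
    "\<forall>x\<in>carrier G. \<forall>y\<in>carrier G. x \<noteq> y \<longrightarrow> c * real (wd x y) powr \<alpha> \<le> sqrt (q x y)"
proof -
  obtain f L c where *: "0 \<le> \<alpha>" "0 < c" "f \<in> carrier G \<rightarrow> L2"
      "\<forall>x\<in>carrier G. \<forall>y\<in>carrier G. L2_dist (f x) (f y) \<le> L * real (wd x y)"
      "\<forall>x\<in>carrier G. \<forall>y\<in>carrier G. x \<noteq> y \<longrightarrow> c * real (wd x y) powr \<alpha> \<le> L2_dist (f x) (f y)"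
    using assms unfolding compression_exponents_def by auto
  have "hilbert_kernel (carrier G) (\<lambda>x y. (L2_dist (f x) (f y))\<^sup>2)"
    using *(3) unfolding hilbert_kernel_def by blast
  then show thesis
    by (rule that[OF *(1,2), of _ L]) (use *(4,5) in simp_all)
qed

text \<open>
  The elements of the countable group \<open>G\<close> are sent to an orthonormal system.
\<close>

lemma zero_compression_exponent: "0 \<in> compression_exponents G S"
proof -
  define q where "q i x y = (of_bool (i = x) - of_bool (i = y) :: real)\<^sup>2" for i x y :: 'a
  have "hilbert_kernel (carrier G) (q i)" for i
    using hilbert_kernel_real[of "carrier G" "\<lambda>x. of_bool (i = x)"] by (simp add: q_def[abs_def])
  moreover have supp: "{i. q i x y \<noteq> 0} = (if x = y then {} else {x, y})" for x y
    by (auto simp: q_def)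
  ultimately have "hilbert_kernel (carrier G) (\<lambda>x y. \<Sum>i | q i x y \<noteq> 0. q i x y)"
    using countable_carrier by (intro hilbert_kernel_sum[of _ \<one>]) (auto simp: supp)
  moreover have "(\<Sum>i | q i x y \<noteq> 0. q i x y) = (if x = y then 0 else 2)" for x y
    by (simp add: supp) (simp add: q_def)
  ultimately have kernel: "hilbert_kernel (carrier G) (\<lambda>x y. if x = y then 0 else 2)" by simp
  have far: "1 \<le> real (wd x y)" if "x \<in> carrier G" "y \<in> carrier G" "x \<noteq> y" for x y
    using word_dist_eq_0[OF that(1,2)] that(3) by simp
  show ?thesis
  proof (rule compression_exponentI[OF order_refl zero_less_one kernel])
    fix x y assume xy: "x \<in> carrier G" "y \<in> carrier G"
    show "sqrt (if x = y then 0 else 2) \<le> sqrt 2 * real (wd x y)"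
    proof (cases "x = y")
      case False
      have "sqrt 2 * 1 \<le> sqrt 2 * real (wd x y)"
        by (rule mult_left_mono[OF far[OF xy False]]) simp
      with False show ?thesis by simp
    qed (use xy in simp)
    show "1 * real (wd x y) powr 0 \<le> sqrt (if x = y then 0 else 2)" if "x \<noteq> y"
      using that by simp
  qed
qed

text \<open>
  For \<open>\<alpha> > 1\<close> the bounds \<open>c * n powr \<alpha>\<close> from below and \<open>L * n\<close> from above are incompatible at
  large distances \<open>n\<close>, and these occur in an infinite group.
\<close>

lemma compression_exponent_le_1:
  assumes inf: "infinite (carrier G)" and "\<alpha> \<in> compression_exponents G S"
  shows "\<alpha> \<le> 1"
proof (rule ccontr)
  assume "\<not> \<alpha> \<le> 1"
  obtain c q L where "0 \<le> \<alpha>" and q: "0 < c" "hilbert_kernel (carrier G) q"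
      "\<forall>x\<in>carrier G. \<forall>y\<in>carrier G. sqrt (q x y) \<le> L * real (wd x y)"
      "\<forall>x\<in>carrier G. \<forall>y\<in>carrier G. x \<noteq> y \<longrightarrow> c * real (wd x y) powr \<alpha> \<le> sqrt (q x y)"
    using assms(2) by (rule compression_exponentE)
  obtain g where g: "g \<in> carrier G" "nat \<lceil>(\<bar>L\<bar> / c) powr (1 / (\<alpha> - 1))\<rceil> < wl g"
    using word_length_unbounded[OF inf] .
  have "wd \<one> g = wl g" using word_dist_mult[of \<one> g] g(1) by simp
  moreover have "g \<noteq> \<one>" using g by auto
  ultimately have "c * real (wl g) powr \<alpha> \<le> sqrt (q \<one> g)" "sqrt (q \<one> g) \<le> L * real (wl g)"
    using q(3,4) g(1) by (metis one_closed)+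
  then have "c * real (wl g) powr \<alpha> \<le> \<bar>L\<bar> * real (wl g)"
    by (meson abs_ge_self dual_order.trans mult_right_mono of_nat_0_le_iff)
  moreover have "real (wl g) powr \<alpha> = real (wl g) powr (\<alpha> - 1) * real (wl g)"
    using g(2) powr_add[of "wl g" "\<alpha> - 1" 1] by simp
  ultimately have "c * real (wl g) powr (\<alpha> - 1) \<le> \<bar>L\<bar>"
    using g(2) by simp
  then have "real (wl g) powr (\<alpha> - 1) \<le> \<bar>L\<bar> / c" using q(1) by (simp add: field_simps)
  then have "(real (wl g) powr (\<alpha> - 1)) powr (1 / (\<alpha> - 1)) \<le> (\<bar>L\<bar> / c) powr (1 / (\<alpha> - 1))"
    using \<open>\<not> \<alpha> \<le> 1\<close> by (intro powr_mono2) auto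
  then have "real (wl g) \<le> (\<bar>L\<bar> / c) powr (1 / (\<alpha> - 1))"
    using \<open>\<not> \<alpha> \<le> 1\<close> by (simp add: powr_powr)
  then show False using g(2) by linarith
qed

lemma bdd_above_compression_exponents:
  "infinite (carrier G) \<Longrightarrow> bdd_above (compression_exponents G S)"
  using compression_exponent_le_1 by (auto simp: bdd_above_def)

end

section \<open>The word metric of \<open>G \<wr> \<int>\<close>\<close>

text \<open>
  \<open>T\<close> is an arbitrary generating set of the wreath product, unrelated to \<open>S\<close>.
\<close>

locale lamplighter = lamps: word_metric G S + W: word_metric "G \<wr> integer_group" T
  for G (structure) and S T
begin

abbreviation "LG \<equiv> G \<wr> integer_group"

lemma in_LG: "(f, x) \<in> carrier LG \<longleftrightarrow> (\<forall>z. f z \<in> carrier G) \<and> finite {z. f z \<noteq> \<one>}"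
  by (auto simp: PiE_iff)

lemma LG_memD: "(f, x) \<in> carrier LG \<Longrightarrow> f z \<in> carrier G" "(f, x) \<in> carrier LG \<Longrightarrow> finite {z. f z \<noteq> \<one>}"
  by (auto simp: in_LG)

lemma LG_mult: "(f, x) \<otimes>\<^bsub>LG\<^esub> (h, k) = (\<lambda>z. f z \<otimes> h (z - x), x + k)"
  by (simp add: restrict_UNIV algebra_simps)

lemma LG_one: "\<one>\<^bsub>LG\<^esub> = (\<lambda>_. \<one>, 0)"
  by (simp add: restrict_UNIV)

declare wreath_simps [simp del]

lemma LG_fun_upd:
  assumes "(f, x) \<in> carrier LG" "b \<in> carrier G"
  shows "(f(z := b), y) \<in> carrier LG"
proof -
  have "finite {u. (f(z := b)) u \<noteq> \<one>}"
    by (rule finite_subset[of _ "insert z {u. f u \<noteq> \<one>}"]) (use assms in \<open>auto simp: in_LG\<close>)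
  with assms show ?thesis by (simp add: in_LG)
qed

lemma LG_move: "(f, x) \<in> carrier LG \<Longrightarrow> (f, y) \<in> carrier LG"
  by (simp add: in_LG)

lemma finite_difference:
  assumes "(f, x) \<in> carrier LG" "(g, y) \<in> carrier LG"
  shows "finite {z. f z \<noteq> g z}"
  by (rule finite_subset[of _ "{z. f z \<noteq> \<one>} \<union> {z. g z \<noteq> \<one>}"]) (use assms in \<open>auto simp: in_LG\<close>)

text \<open>
  Right multiplication by \<open>lamp g\<close> multiplies the lamp at the current position by \<open>g\<close>.
\<close>

definition lamp :: "'a \<Rightarrow> (int \<Rightarrow> 'a) \<times> int" where
  "lamp g = ((\<lambda>_. \<one>)(0 := g), 0)"

lemma lamp_in_LG: "g \<in> carrier G \<Longrightarrow> lamp g \<in> carrier LG"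
  unfolding lamp_def by (rule LG_fun_upd[of _ 0]) (auto simp: in_LG)

lemma mult_lamp: "(f, x) \<in> carrier LG \<Longrightarrow> g \<in> carrier G \<Longrightarrow> (f, x) \<otimes>\<^bsub>LG\<^esub> lamp g = (f(x := f x \<otimes> g), x)"
  by (auto simp: lamp_def LG_mult fun_eq_iff in_LG)

definition shift :: "int \<Rightarrow> (int \<Rightarrow> 'a) \<times> int" where
  "shift k = (\<lambda>_. \<one>, k)"

lemma shift_in_LG: "shift k \<in> carrier LG"
  by (simp add: shift_def in_LG)

lemma mult_shift: "(f, x) \<in> carrier LG \<Longrightarrow> (f, x) \<otimes>\<^bsub>LG\<^esub> shift k = (f, x + k)"
  by (auto simp: shift_def LG_mult fun_eq_iff in_LG)

text \<open>
  As \<open>lamp\<close> is a homomorphism, its values on the finitely many generators of \<open>G\<close> bound it.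
\<close>

lemma lamp_length: "\<exists>C\<ge>0. \<forall>g\<in>carrier G. real (W.wl (lamp g)) \<le> C * real (lamps.wl g)"
proof -
  define C where "C = (\<Sum>s\<in>S. real (W.wl (lamp s)))"
  have "real (W.wl (lamp g)) \<le> C * real (lamps.wl g)" if g: "g \<in> carrier G" for g
  proof -
    have mult: "lamp a \<otimes>\<^bsub>LG\<^esub> lamp b = lamp (a \<otimes> b)" if "a \<in> carrier G" "b \<in> carrier G" for a b
      using mult_lamp[of "(\<lambda>_. \<one>)(0 := a)" 0 b] lamp_in_LG[OF that(1)] that by (simp add: lamp_def)
    have one: "lamp \<one> = \<one>\<^bsub>LG\<^esub>" by (auto simp: lamp_def LG_one)
    have inv_mult: "inv x \<otimes> z = inv x \<otimes> y \<otimes> (inv y \<otimes> z)"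
      if "x \<in> carrier G" "y \<in> carrier G" "z \<in> carrier G" for x y z
    proof -
      have "y \<otimes> (inv y \<otimes> z) = z" using that by (simp flip: lamps.m_assoc)
      then show ?thesis using that by (simp add: lamps.m_assoc)
    qed
    have "real (W.wl (lamp (inv \<one> \<otimes> g))) \<le> C * real (lamps.wd \<one> g)"
    proof (rule lamps.lipschitz_from_generators[where d = "\<lambda>a b. real (W.wl (lamp (inv a \<otimes> b)))"])
      fix x y z assume xyz: "x \<in> carrier G" "y \<in> carrier G" "z \<in> carrier G"
      have "W.wl (lamp (inv x \<otimes> y) \<otimes>\<^bsub>LG\<^esub> lamp (inv y \<otimes> z)) \<le>
          W.wl (lamp (inv x \<otimes> y)) + W.wl (lamp (inv y \<otimes> z))"
        using xyz by (intro W.word_length_mult lamp_in_LG) auto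
      then show "real (W.wl (lamp (inv x \<otimes> z))) \<le>
          real (W.wl (lamp (inv x \<otimes> y))) + real (W.wl (lamp (inv y \<otimes> z)))"
        using xyz by (simp add: mult inv_mult[OF xyz])
    next
      fix x s assume "x \<in> carrier G" "s \<in> S"
      then have "inv x \<otimes> (x \<otimes> s) = s"
        using lamps.generators(2) by (simp flip: lamps.m_assoc)
      moreover have "real (W.wl (lamp s)) \<le> C"
        unfolding C_def using \<open>s \<in> S\<close> lamps.generators(1) by (intro member_le_sum) auto
      ultimately show "real (W.wl (lamp (inv x \<otimes> (x \<otimes> s)))) \<le> C" by simp
    qed (use g in \<open>simp_all add: one\<close>)
    then show ?thesis using g lamps.word_dist_mult[of \<one> g] by simp
  qed
  moreover have "0 \<le> C" by (simp add: C_def sum_nonneg)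
  ultimately show ?thesis by blast
qed

text \<open>
  The walk goes from \<open>x\<close> to the left end \<open>x - M\<close> of the range, then to the right through all \<open>2 * M + 1\<close>
  sites, correcting each lamp on the way, and then back to \<open>y\<close>.  It is stated for a pseudometric \<open>d\<close>
  because it serves both for the word metric (an upper bound for distances) and for
  the distance between images in \<open>L\<^sub>2\<close> (a Lipschitz bound).
\<close>

lemma sweep:
  fixes d :: "(int \<Rightarrow> 'a) \<times> int \<Rightarrow> (int \<Rightarrow> 'a) \<times> int \<Rightarrow> real"
  assumes tri: "\<And>p q r. p \<in> carrier LG \<Longrightarrow> q \<in> carrier LG \<Longrightarrow> r \<in> carrier LG \<Longrightarrow> d p r \<le> d p q + d q r"
    and refl: "\<And>p. p \<in> carrier LG \<Longrightarrow> d p p = 0"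
    and C: "0 \<le> C"
    and switch: "\<And>f x b. (f, x) \<in> carrier LG \<Longrightarrow> b \<in> carrier G \<Longrightarrow>
      d (f, x) (f(x := b), x) \<le> C * real (lamps.wd (f x) b)"
    and right: "\<And>f x. (f, x) \<in> carrier LG \<Longrightarrow> d (f, x) (f, x + 1) \<le> C"
    and left: "\<And>f x. (f, x) \<in> carrier LG \<Longrightarrow> d (f, x + 1) (f, x) \<le> C"
    and f: "(f, x) \<in> carrier LG" and g: "(g, y) \<in> carrier LG"
    and M: "\<bar>x - y\<bar> \<le> int M" "\<And>z. f z \<noteq> g z \<Longrightarrow> \<bar>z - x\<bar> \<le> int M"
  shows "d (f, x) (g, y) \<le> C * ((\<Sum>z | f z \<noteq> g z. real (lamps.wd (f z) (g z))) + 5 * real M + 2)"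
proof -
  have right_n: "d (h, u) (h, u + int n) \<le> C * real n" if "(h, u) \<in> carrier LG" for h u n
  proof (induction n)
    case 0
    then show ?case using refl[OF that] by simp
  next
    case (Suc n)
    have "d (h, u) (h, u + int (Suc n)) \<le> d (h, u) (h, u + int n) + d (h, u + int n) (h, u + int n + 1)"
      using tri[OF that LG_move[OF that, of "u + int n"] LG_move[OF that, of "u + int n + 1"]]
      by (simp add: add.assoc add.commute[of 1])
    also have "\<dots> \<le> C * real n + C"
      by (intro add_mono Suc right LG_move[OF that])
    finally show ?case by (simp add: algebra_simps)
  qed
  have left_n: "d (h, u + int n) (h, u) \<le> C * real n" if "(h, u) \<in> carrier LG" for h u n
  proof (induction n)
    case 0
    then show ?case using refl[OF that] by simp
  next
    case (Suc n)
    have "d (h, u + int (Suc n)) (h, u) \<le> d (h, u + int n + 1) (h, u + int n) + d (h, u + int n) (h, u)"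
      using tri[OF LG_move[OF that, of "u + int n + 1"] LG_move[OF that, of "u + int n"] that]
      by (simp add: add.assoc add.commute[of 1])
    also have "\<dots> \<le> C + C * real n"
      by (intro add_mono Suc left LG_move[OF that])
    finally show ?case by (simp add: algebra_simps)
  qed
  have path: "d (h, a) (k, a + int n) \<le> C * ((\<Sum>z = a..<a + int n. real (lamps.wd (h z) (k z))) + real n)"
    if h: "(h, a) \<in> carrier LG" and k: "(k, a) \<in> carrier LG"
      and "\<And>z. h z \<noteq> k z \<Longrightarrow> z \<in> {a..<a + int n}" for h k a n
    using k that(3)
  proof (induction n arbitrary: k)
    case 0
    then have "h = k" by force
    then show ?case using refl[OF h] by simp
  next
    case (Suc n)
    define v where "v = a + int n"
    \<comment> \<open>Everything is corrected except the last site \<open>v\<close>, where the walk arrives next.\<close>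
    define k' where "k' = k(v := h v)"
    have k': "(k', u) \<in> carrier LG" for u
      unfolding k'_def using LG_fun_upd[OF Suc.prems(1)] h by (simp add: in_LG)
    have kk: "k v \<in> carrier G" "(k, u) \<in> carrier LG" for u
      using Suc.prems(1) by (auto simp: in_LG)
    have "z \<in> {a..<a + int n}" if "h z \<noteq> k' z" for z
      using that Suc.prems(2)[of z] by (cases "z = v") (auto simp: k'_def v_def)
    then have IH: "d (h, a) (k', v) \<le> C * ((\<Sum>z = a..<v. real (lamps.wd (h z) (k' z))) + real n)"
      unfolding v_def by (rule Suc.IH[OF k'])
    have eq: "(\<Sum>z = a..<v. real (lamps.wd (h z) (k' z))) = (\<Sum>z = a..<v. real (lamps.wd (h z) (k z)))"
      by (intro sum.cong) (auto simp: k'_def)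
    have "d (k', v) (k, v) \<le> C * real (lamps.wd (h v) (k v))"
      using switch[OF k'[of v] kk(1)] by (simp add: k'_def fun_upd_idem)
    moreover have "d (h, a) (k, v + 1) \<le> d (h, a) (k', v) + d (k', v) (k, v) + d (k, v) (k, v + 1)"
      using tri[OF h k'[of v] kk(2)[of "v + 1"]] tri[OF k'[of v] kk(2)[of v] kk(2)[of "v + 1"]] by linarith
    moreover have "d (k, v) (k, v + 1) \<le> C" by (rule right[OF kk(2)])
    ultimately have "d (h, a) (k, v + 1) \<le> C * ((\<Sum>z = a..<v. real (lamps.wd (h z) (k z))) + real n)
        + C * real (lamps.wd (h v) (k v)) + C"
      using IH unfolding eq by linarith
    also have "\<dots> = C * ((\<Sum>z \<in> insert v {a..<v}. real (lamps.wd (h z) (k z))) + real (Suc n))"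
      by (simp add: algebra_simps)
    also have "insert v {a..<v} = {a..<a + int (Suc n)}" by (auto simp: v_def)
    finally show ?case by (simp add: v_def ac_simps)
  qed
  define a where "a = x - int M"
  define n where "n = 2 * M + 1"
  \<comment> \<open>The sweep ends at \<open>x + M + 1\<close>, which lies \<open>e\<close> steps to the right of \<open>y\<close>.\<close>
  define e where "e = nat (a + int n - y)"
  have "d (f, x) (g, y) \<le> d (f, a + int M) (f, a) + d (f, a) (g, a + int n) + d (g, y + int e) (g, y)"
  proof -
    have "a + int M = x" "a + int n = y + int e" using M(1) by (auto simp: a_def n_def e_def)
    then show ?thesis
      using tri[OF f LG_move[OF f, of a] g]
        tri[OF LG_move[OF f, of a] LG_move[OF g, of "a + int n"] g] by simp
  qed
  also have "\<dots> \<le> C * real M + C * ((\<Sum>z = a..<a + int n. real (lamps.wd (f z) (g z))) + real n) + C * real e"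
    using LG_move[OF f] g LG_move[OF g] M(2)
    by (intro add_mono left_n path) (force simp: a_def n_def)+
  also have "(\<Sum>z = a..<a + int n. real (lamps.wd (f z) (g z))) = (\<Sum>z | f z \<noteq> g z. real (lamps.wd (f z) (g z)))"
    using M(2) g by (intro sum.mono_neutral_right) (force simp: a_def n_def in_LG)+
  also have "C * real M + C * ((\<Sum>z | f z \<noteq> g z. real (lamps.wd (f z) (g z))) + real n) + C * real e
      = C * ((\<Sum>z | f z \<noteq> g z. real (lamps.wd (f z) (g z))) + real (M + n + e))"
    by (simp add: algebra_simps)
  also have "\<dots> \<le> C * ((\<Sum>z | f z \<noteq> g z. real (lamps.wd (f z) (g z))) + real (5 * M + 2))"
    using C M(1) by (intro mult_left_mono add_left_mono of_nat_mono) (auto simp: n_def e_def a_def)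
  finally show ?thesis by (simp add: ac_simps)
qed

lemma word_dist_upper_bound:
  "\<exists>C\<ge>0. \<forall>f x g y M. (f, x) \<in> carrier LG \<longrightarrow> (g, y) \<in> carrier LG \<longrightarrow> \<bar>x - y\<bar> \<le> int M \<longrightarrow>
     (\<forall>z. f z \<noteq> g z \<longrightarrow> \<bar>z - x\<bar> \<le> int M) \<longrightarrow>
     real (W.wd (f, x) (g, y)) \<le> C * ((\<Sum>z | f z \<noteq> g z. real (lamps.wd (f z) (g z))) + 5 * real M + 2)"
proof -
  obtain C\<^sub>0 where C\<^sub>0: "0 \<le> C\<^sub>0" "\<And>g. g \<in> carrier G \<Longrightarrow> real (W.wl (lamp g)) \<le> C\<^sub>0 * real (lamps.wl g)"
    using lamp_length by auto
  define C where "C = C\<^sub>0 + real (W.wl (shift 1)) + real (W.wl (shift (-1)))"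
  have C: "0 \<le> C" "C\<^sub>0 \<le> C" using C\<^sub>0(1) by (simp_all add: C_def)
  have switch: "real (W.wd (f, x) (f(x := b), x)) \<le> C * real (lamps.wd (f x) b)"
    if f: "(f, x) \<in> carrier LG" and b: "b \<in> carrier G" for f x b
  proof -
    have fx: "f x \<in> carrier G" using f by (simp add: in_LG)
    have "f x \<otimes> (inv f x \<otimes> b) = b" using fx b by (simp flip: lamps.m_assoc)
    then have "(f(x := b), x) = (f, x) \<otimes>\<^bsub>LG\<^esub> lamp (inv f x \<otimes> b)"
      using mult_lamp[OF f, of "inv f x \<otimes> b"] fx b by simp
    then have "W.wd (f, x) (f(x := b), x) = W.wl (lamp (inv f x \<otimes> b))"
      using W.word_dist_mult[OF f lamp_in_LG, of "inv f x \<otimes> b"] fx b by simp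
    also have "real \<dots> \<le> C\<^sub>0 * real (lamps.wd (f x) b)"
      using C\<^sub>0(2)[of "inv f x \<otimes> b"] fx b by (simp add: word_dist_def)
    also have "\<dots> \<le> C * real (lamps.wd (f x) b)" using C(2) by (intro mult_right_mono) auto
    finally show ?thesis .
  qed
  have move: "W.wd (f, x) (f, x + k) = W.wl (shift k)" if "(f, x) \<in> carrier LG" for f x k
    using W.word_dist_mult[OF that shift_in_LG, of k] mult_shift[OF that] by simp
  have right: "real (W.wd (f, x) (f, x + 1)) \<le> C" if "(f, x) \<in> carrier LG" for f x
    using move[OF that, of 1] C\<^sub>0(1) by (simp add: C_def)
  have left: "real (W.wd (f, x + 1) (f, x)) \<le> C" if "(f, x) \<in> carrier LG" for f x
    using move[OF LG_move[OF that, of "x + 1"], of "-1"] C\<^sub>0(1) by (simp add: C_def)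
  have tri: "real (W.wd p r) \<le> real (W.wd p q) + real (W.wd q r)"
    if "p \<in> carrier LG" "q \<in> carrier LG" "r \<in> carrier LG" for p q r
    using W.word_dist_triangle[OF that] by linarith
  have "real (W.wd (f, x) (g, y)) \<le> C * ((\<Sum>z | f z \<noteq> g z. real (lamps.wd (f z) (g z))) + 5 * real M + 2)"
    if "(f, x) \<in> carrier LG" "(g, y) \<in> carrier LG" "\<bar>x - y\<bar> \<le> int M"
      "\<forall>z. f z \<noteq> g z \<longrightarrow> \<bar>z - x\<bar> \<le> int M" for f x g y M
    by (rule sweep[where d = "\<lambda>p q. real (W.wd p q)"]) (use tri C switch right left that in auto)
  then show ?thesis using C(1) by (intro exI[of _ C]) auto
qed

text \<open>
  A generator \<open>t\<close> in \<open>T\<close> may change many lamps, but their number, their distance from the position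
  and the sizes of the changes depend on \<open>t\<close> only.
\<close>

lemma lipschitz_from_moves:
  fixes d :: "(int \<Rightarrow> 'a) \<times> int \<Rightarrow> (int \<Rightarrow> 'a) \<times> int \<Rightarrow> real"
  assumes tri: "\<And>p q r. p \<in> carrier LG \<Longrightarrow> q \<in> carrier LG \<Longrightarrow> r \<in> carrier LG \<Longrightarrow> d p r \<le> d p q + d q r"
    and refl: "\<And>p. p \<in> carrier LG \<Longrightarrow> d p p = 0"
    and C: "0 \<le> C"
    and switch: "\<And>f x b. (f, x) \<in> carrier LG \<Longrightarrow> b \<in> carrier G \<Longrightarrow>
      d (f, x) (f(x := b), x) \<le> C * real (lamps.wd (f x) b)"
    and right: "\<And>f x. (f, x) \<in> carrier LG \<Longrightarrow> d (f, x) (f, x + 1) \<le> C"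
    and left: "\<And>f x. (f, x) \<in> carrier LG \<Longrightarrow> d (f, x + 1) (f, x) \<le> C"
  shows "\<exists>L. \<forall>p\<in>carrier LG. \<forall>q\<in>carrier LG. d p q \<le> L * real (W.wd p q)"
proof -
  have "\<exists>L. \<forall>p\<in>carrier LG. d p (p \<otimes>\<^bsub>LG\<^esub> t) \<le> L" if "t \<in> T" for t
  proof -
    obtain h k where t: "t = (h, k)" by (cases t)
    have hk: "(h, k) \<in> carrier LG" using W.generators(2)[OF that] t by simp
    define M where "M = nat (\<bar>k\<bar> + (\<Sum>z | h z \<noteq> \<one>. \<bar>z\<bar>))"
    have M: "\<bar>k\<bar> \<le> int M" by (simp add: M_def sum_nonneg)
    have supp: "\<bar>u\<bar> \<le> int M" if "h u \<noteq> \<one>" for u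
    proof -
      have "\<bar>u\<bar> \<le> (\<Sum>z | h z \<noteq> \<one>. \<bar>z\<bar>)"
        using that LG_memD(2)[OF hk] by (intro member_le_sum) auto
      then show ?thesis by (simp add: M_def)
    qed
    have "d p (p \<otimes>\<^bsub>LG\<^esub> t) \<le> C * ((\<Sum>u | h u \<noteq> \<one>. real (lamps.wl (h u))) + 5 * real M + 2)"
      if "p \<in> carrier LG" for p
    proof -
      obtain f x where p: "p = (f, x)" by (cases p)
      then have fx: "(f, x) \<in> carrier LG" using that by simp
      define g where "g = (\<lambda>z. f z \<otimes> h (z - x))"
      have pt: "p \<otimes>\<^bsub>LG\<^esub> t = (g, x + k)" by (simp add: p t LG_mult g_def)
      then have g: "(g, x + k) \<in> carrier LG"
        using W.m_closed[OF that, of t] W.generators(2)[OF \<open>t \<in> T\<close>] by simp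
      have neq: "f z \<noteq> g z \<longleftrightarrow> h (z - x) \<noteq> \<one>" for z
        using LG_memD(1)[OF fx, of z] LG_memD(1)[OF hk, of "z - x"] lamps.r_cancel_one'[of "f z" "h (z - x)"]
        by (auto simp: g_def)
      have "(\<Sum>z | f z \<noteq> g z. real (lamps.wd (f z) (g z))) = (\<Sum>z | f z \<noteq> g z. real (lamps.wl (h (z - x))))"
        using LG_memD(1)[OF fx] LG_memD(1)[OF hk] by (simp add: g_def lamps.word_dist_mult)
      also have "\<dots> = (\<Sum>u | h u \<noteq> \<one>. real (lamps.wl (h u)))"
        by (rule sum.reindex_bij_witness[of _ "\<lambda>u. u + x" "\<lambda>z. z - x"]) (auto simp: neq)
      finally have sum: "(\<Sum>z | f z \<noteq> g z. real (lamps.wd (f z) (g z))) = \<dots>" .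
      have "d (f, x) (g, x + k) \<le> C * ((\<Sum>z | f z \<noteq> g z. real (lamps.wd (f z) (g z))) + 5 * real M + 2)"
        by (rule sweep[OF tri refl C switch right left fx g]) (use M supp neq in auto)
      then show ?thesis unfolding sum by (simp only: p pt[unfolded p])
    qed
    then show ?thesis by blast
  qed
  then obtain L where L: "\<And>t p. t \<in> T \<Longrightarrow> p \<in> carrier LG \<Longrightarrow> d p (p \<otimes>\<^bsub>LG\<^esub> t) \<le> L t" by metis
  have "d p q \<le> (\<Sum>t\<in>T. \<bar>L t\<bar>) * real (W.wd p q)" if "p \<in> carrier LG" "q \<in> carrier LG" for p q
  proof (rule W.lipschitz_from_generators[OF tri refl _ that])
    fix p t assume pt: "p \<in> carrier LG" "t \<in> T"
    have "\<bar>L t\<bar> \<le> (\<Sum>t\<in>T. \<bar>L t\<bar>)" using pt(2) W.generators(1) by (intro member_le_sum) auto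
    then show "d p (p \<otimes>\<^bsub>LG\<^esub> t) \<le> (\<Sum>t\<in>T. \<bar>L t\<bar>)" using L[OF pt(2,1)] by linarith
  qed
  then show ?thesis by blast
qed

text \<open>
  A generator in \<open>T\<close> changes the lamp at \<open>0\<close> by a bounded amount, so this lamp is a Lipschitz
  function on the wreath product.
\<close>

lemma word_dist_lamp_lower_bound:
  "\<exists>K>0. \<forall>a\<in>carrier G. \<forall>b\<in>carrier G. real (lamps.wd a b) \<le> K * real (W.wd (lamp a) (lamp b))"
proof -
  define d where "d p q = real (lamps.wd (fst p 0) (fst q 0))" for p q :: "(int \<Rightarrow> 'a) \<times> int"
  define K where "K = 1 + (\<Sum>t\<in>T. \<Sum>u | fst t u \<noteq> \<one>. real (lamps.wl (fst t u)))"
  have K: "0 < K" by (simp add: K_def add_pos_nonneg sum_nonneg)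
  have d: "d p q \<le> K * real (W.wd p q)" if "p \<in> carrier LG" "q \<in> carrier LG" for p q
  proof (rule W.lipschitz_from_generators[OF _ _ _ that])
    fix p t assume pt: "p \<in> carrier LG" "t \<in> T"
    obtain f x h k where [simp]: "p = (f, x)" "t = (h, k)" by (cases p; cases t)
    have h: "(h, k) \<in> carrier LG" using W.generators(2)[OF pt(2)] by simp
    have "d p (p \<otimes>\<^bsub>LG\<^esub> t) = real (lamps.wl (h (- x)))"
      using pt(1) h by (simp add: d_def LG_mult in_LG lamps.word_dist_mult)
    also have "\<dots> \<le> (\<Sum>u | h u \<noteq> \<one>. real (lamps.wl (h u)))"
    proof (cases "h (- x) = \<one>")
      case False
      then show ?thesis using LG_memD(2)[OF h] by (intro member_le_sum) auto
    qed (simp add: sum_nonneg)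
    also have "\<dots> \<le> (\<Sum>t\<in>T. \<Sum>u | fst t u \<noteq> \<one>. real (lamps.wl (fst t u)))"
      using member_le_sum[OF pt(2), of "\<lambda>t. \<Sum>u | fst t u \<noteq> \<one>. real (lamps.wl (fst t u))"] W.generators(1)
      by (simp add: sum_nonneg)
    finally show "d p (p \<otimes>\<^bsub>LG\<^esub> t) \<le> K" by (simp add: K_def)
  next
    fix p q r assume "p \<in> carrier LG" "q \<in> carrier LG" "r \<in> carrier LG"
    then have "fst p 0 \<in> carrier G" "fst q 0 \<in> carrier G" "fst r 0 \<in> carrier G"
      by (metis LG_memD(1) prod.collapse)+
    then show "d p r \<le> d p q + d q r"
      unfolding d_def using lamps.word_dist_triangle by (metis of_nat_add of_nat_mono)
  next
    fix p assume "p \<in> carrier LG"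
    then have "fst p 0 \<in> carrier G" by (metis LG_memD(1) prod.collapse)
    then show "d p p = 0" by (simp add: d_def)
  qed
  have "real (lamps.wd a b) \<le> K * real (W.wd (lamp a) (lamp b))" if "a \<in> carrier G" "b \<in> carrier G" for a b
    using d[OF lamp_in_LG[OF that(1)] lamp_in_LG[OF that(2)]] by (simp add: d_def lamp_def)
  then show ?thesis using K by blast
qed

text \<open>
  The map \<open>lamp\<close> embeds \<open>G\<close> bi-Lipschitzly, so every map on the wreath product restricts to one on \<open>G\<close>.
\<close>

lemma compression_exponents_subset: "compression_exponents LG T \<subseteq> compression_exponents G S"
proof
  fix \<alpha> assume "\<alpha> \<in> compression_exponents LG T"
  then obtain c q L where \<alpha>: "0 \<le> \<alpha>" and c: "0 < c" and q: "hilbert_kernel (carrier LG) q"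
      and up: "\<forall>x\<in>carrier LG. \<forall>y\<in>carrier LG. sqrt (q x y) \<le> L * real (W.wd x y)"
      and lo: "\<forall>x\<in>carrier LG. \<forall>y\<in>carrier LG. x \<noteq> y \<longrightarrow> c * real (W.wd x y) powr \<alpha> \<le> sqrt (q x y)"
    by (rule W.compression_exponentE)
  obtain C where C: "0 \<le> C" "\<And>g. g \<in> carrier G \<Longrightarrow> real (W.wl (lamp g)) \<le> C * real (lamps.wl g)"
    using lamp_length by auto
  obtain K where K: "0 < K"
      "\<And>a b. a \<in> carrier G \<Longrightarrow> b \<in> carrier G \<Longrightarrow> real (lamps.wd a b) \<le> K * real (W.wd (lamp a) (lamp b))"
    using word_dist_lamp_lower_bound by auto
  have kernel: "hilbert_kernel (carrier G) (\<lambda>a b. q (lamp a) (lamp b))"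
    by (rule hilbert_kernel_comp[OF q]) (simp add: lamp_in_LG)
  show "\<alpha> \<in> compression_exponents G S"
  proof (rule lamps.compression_exponentI[OF \<alpha> _ kernel])
    show "0 < c / K powr \<alpha>" using c K by simp
    fix a b assume ab: "a \<in> carrier G" "b \<in> carrier G"
    have "lamp a \<otimes>\<^bsub>LG\<^esub> lamp (inv a \<otimes> b) = lamp b"
      using mult_lamp[OF lamp_in_LG[OF ab(1), unfolded lamp_def], of "inv a \<otimes> b"] ab
      by (simp add: lamp_def flip: lamps.m_assoc)
    then have "W.wd (lamp a) (lamp b) = W.wl (lamp (inv a \<otimes> b))"
      using W.word_dist_mult[of "lamp a" "lamp (inv a \<otimes> b)"] ab by (simp add: lamp_in_LG)
    then have le: "real (W.wd (lamp a) (lamp b)) \<le> C * real (lamps.wd a b)"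
      using C(2)[of "inv a \<otimes> b"] ab by (simp add: word_dist_def)
    have "sqrt (q (lamp a) (lamp b)) \<le> L * real (W.wd (lamp a) (lamp b))"
      using up ab by (simp add: lamp_in_LG)
    also have "\<dots> \<le> \<bar>L\<bar> * real (W.wd (lamp a) (lamp b))" by (intro mult_right_mono) auto
    also have "\<dots> \<le> \<bar>L\<bar> * (C * real (lamps.wd a b))" using le by (intro mult_left_mono) auto
    finally show "sqrt (q (lamp a) (lamp b)) \<le> (\<bar>L\<bar> * C) * real (lamps.wd a b)" by (simp add: mult.assoc)
    assume "a \<noteq> b"
    then have "lamp a \<noteq> lamp b" by (auto simp: lamp_def fun_eq_iff)
    have "real (lamps.wd a b) powr \<alpha> \<le> (K * real (W.wd (lamp a) (lamp b))) powr \<alpha>"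
      using K(2)[OF ab] \<alpha> by (intro powr_mono2) auto
    also have "\<dots> = K powr \<alpha> * real (W.wd (lamp a) (lamp b)) powr \<alpha>"
      using K(1) by (simp add: powr_mult)
    finally have "c / K powr \<alpha> * real (lamps.wd a b) powr \<alpha> \<le> c * real (W.wd (lamp a) (lamp b)) powr \<alpha>"
      using c K(1) by (simp add: field_simps)
    also have "\<dots> \<le> sqrt (q (lamp a) (lamp b))"
      using lo ab \<open>lamp a \<noteq> lamp b\<close> by (simp add: lamp_in_LG)
    finally show "c / K powr \<alpha> * real (lamps.wd a b) powr \<alpha> \<le> sqrt (q (lamp a) (lamp b))" .
  qed
qed

end

section \<open>Weights of finite energy\<close>

text \<open>
  The maximum makes the weight vanish for \<open>t \<le> 0\<close> also when \<open>\<beta> = 0\<close>, because \<open>0 powr 0 = 0\<close>.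
\<close>

definition ramp :: "real \<Rightarrow> int \<Rightarrow> real" where
  "ramp \<beta> t = real_of_int (max 0 t) powr \<beta>"

lemma ramp_nonpos [simp]: "t \<le> 0 \<Longrightarrow> ramp \<beta> t = 0"
  by (simp add: ramp_def)

lemma ramp_nonneg [simp]: "0 \<le> ramp \<beta> t"
  by (simp add: ramp_def)

lemma ramp_mono: "0 \<le> \<beta> \<Longrightarrow> s \<le> t \<Longrightarrow> ramp \<beta> s \<le> ramp \<beta> t"
  by (auto simp: ramp_def intro!: powr_mono2)

text \<open>
  For \<open>u \<ge> 1\<close> one has \<open>(1 + 1 / u) powr \<beta> \<le> 1 + 1 / u\<close>, hence
  \<open>(u + 1) powr \<beta> - u powr \<beta> \<le> u powr (\<beta> - 1)\<close>.
\<close>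

lemma ramp_increment:
  assumes "0 \<le> \<beta>" "\<beta> \<le> 1" "0 \<le> t"
  shows "(ramp \<beta> (t + 1) - ramp \<beta> t)\<^sup>2 \<le> of_bool (t = 0) + real (nat t) powr (2 * \<beta> - 2)"
proof (cases "t = 0")
  case True
  then show ?thesis by (simp add: ramp_def)
next
  case False
  define u where "u = real_of_int t"
  have u: "1 \<le> u" using False assms(3) by (simp add: u_def)
  have "u + 1 = u * (1 + 1 / u)" using u by (simp add: field_simps)
  then have "(u + 1) powr \<beta> = u powr \<beta> * (1 + 1 / u) powr \<beta>" using u by (simp add: powr_mult)
  also have "\<dots> \<le> u powr \<beta> * (1 + 1 / u)"
    using powr_mono[of \<beta> 1 "1 + 1 / u"] u assms by (intro mult_left_mono) auto
  also have "\<dots> = u powr \<beta> + u powr (\<beta> - 1)"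
    using u by (simp add: powr_diff distrib_left)
  finally have "(u + 1) powr \<beta> - u powr \<beta> \<le> u powr (\<beta> - 1)" by simp
  moreover have "u powr \<beta> \<le> (u + 1) powr \<beta>" using u assms by (intro powr_mono2) auto
  ultimately have "((u + 1) powr \<beta> - u powr \<beta>)\<^sup>2 \<le> (u powr (\<beta> - 1))\<^sup>2"
    by (intro power_mono) auto
  also have "\<dots> = u powr (2 * \<beta> - 2)"
    by (simp add: power2_eq_square flip: powr_add)
  finally show ?thesis using False assms(3) by (simp add: ramp_def u_def)
qed

text \<open>
  This is where \<open>\<beta> < 1/2\<close> enters: the series of \<open>n powr (2 * \<beta> - 2)\<close> converges.
\<close>

lemma ramp_energy:
  assumes "0 \<le> \<beta>" "\<beta> < 1 / 2"
  obtains B where "0 \<le> B" "\<And>K. finite K \<Longrightarrow> (\<Sum>t\<in>K. (ramp \<beta> (t + 1) - ramp \<beta> t)\<^sup>2) \<le> B"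
proof
  define b where "b n = of_bool (n = 0) + real n powr (2 * \<beta> - 2)" for n :: nat
  have b: "0 \<le> b n" for n by (simp add: b_def)
  have "summable (\<lambda>n. of_bool (n = (0::nat)) :: real)"
    by (rule summable_finite[of "{0}"]) auto
  moreover have "summable (\<lambda>n. real n powr (2 * \<beta> - 2))"
    using assms by (subst summable_real_powr_iff) auto
  ultimately have sb: "summable b"
    unfolding b_def by (rule summable_add)
  show "0 \<le> suminf b" using sb b by (rule suminf_nonneg)
  fix K :: "int set" assume K: "finite K"
  have "(\<Sum>t\<in>K. (ramp \<beta> (t + 1) - ramp \<beta> t)\<^sup>2) = (\<Sum>t\<in>K \<inter> {0..}. (ramp \<beta> (t + 1) - ramp \<beta> t)\<^sup>2)"
  proof (rule sum.mono_neutral_right[OF K])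
    show "\<forall>t\<in>K - K \<inter> {0..}. (ramp \<beta> (t + 1) - ramp \<beta> t)\<^sup>2 = 0"
    proof
      fix t assume "t \<in> K - K \<inter> {0..}"
      then have "t + 1 \<le> 0" "t \<le> 0" by auto
      then show "(ramp \<beta> (t + 1) - ramp \<beta> t)\<^sup>2 = 0" by simp
    qed
  qed auto
  also have "\<dots> \<le> (\<Sum>t\<in>K \<inter> {0..}. b (nat t))"
  proof (rule sum_mono)
    fix t assume "t \<in> K \<inter> {0..}"
    then show "(ramp \<beta> (t + 1) - ramp \<beta> t)\<^sup>2 \<le> b (nat t)"
      using ramp_increment[of \<beta> t] assms by (auto simp: b_def)
  qed
  also have "\<dots> = sum b (nat ` (K \<inter> {0..}))"
    by (subst sum.reindex) (auto simp: inj_on_def)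
  also have "\<dots> \<le> suminf b" using K b by (intro sum_le_suminf[OF sb]) auto
  finally show "(\<Sum>t\<in>K. (ramp \<beta> (t + 1) - ramp \<beta> t)\<^sup>2) \<le> suminf b" .
qed

text \<open>
  Since \<open>2 * \<beta> - 1 \<le> 0\<close>, each term is at least \<open>i * N powr (2 * \<beta> - 1)\<close>, and the numbers
  \<open>1, \<dots>, N\<close> add up to at least \<open>N\<^sup>2 / 2\<close>.
\<close>

lemma sum_powr_lower_bound:
  assumes "0 \<le> \<beta>" "\<beta> \<le> 1 / 2"
  shows "real N powr (2 * \<beta> + 1) / 2 \<le> (\<Sum>i=1..N. real i powr (2 * \<beta>))"
proof (cases "N = 0")
  case False
  have "real N powr (2 * \<beta> + 1) = real N * real N * real N powr (2 * \<beta> - 1)"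
    using False by (simp add: powr_add powr_diff)
  also have "\<dots> / 2 \<le> real N * (real N + 1) / 2 * real N powr (2 * \<beta> - 1)"
  proof -
    have "real N * real N \<le> real N * (real N + 1)" by (intro mult_left_mono) auto
    then have "real N * real N * real N powr (2 * \<beta> - 1) \<le> real N * (real N + 1) * real N powr (2 * \<beta> - 1)"
      by (rule mult_right_mono) simp
    then show ?thesis by simp
  qed
  also have "real N * (real N + 1) / 2 = (\<Sum>i=1..N. real i)"
    by (induction N) (auto simp: field_simps)
  also have "(\<Sum>i=1..N. real i) * real N powr (2 * \<beta> - 1) = (\<Sum>i=1..N. real i * real N powr (2 * \<beta> - 1))"
    by (rule sum_distrib_right)
  also have "\<dots> \<le> (\<Sum>i=1..N. real i powr (2 * \<beta>))"
  proof (rule sum_mono)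
    fix i assume i: "i \<in> {1..N}"
    have "real i * real N powr (2 * \<beta> - 1) \<le> real i * real i powr (2 * \<beta> - 1)"
      using i assms by (intro mult_left_mono powr_mono2') auto
    also have "\<dots> = real i powr (2 * \<beta>)" using i by (simp add: powr_diff)
    finally show "real i * real N powr (2 * \<beta> - 1) \<le> real i powr (2 * \<beta>)" .
  qed
  finally show ?thesis .
qed simp

section \<open>Balancing the lamps against the range\<close>

text \<open>
  With \<open>D\<close> the sum of the \<open>d i\<close>, the left-hand side is the sum of the \<open>d i * D powr (p - 1)\<close>, and
  \<open>d i \<le> D\<close> while \<open>p - 1 \<le> 0\<close>.
\<close>

lemma powr_sum_le:
  fixes d :: "'i \<Rightarrow> nat"
  assumes A: "finite A" "\<And>i. i \<in> A \<Longrightarrow> 1 \<le> d i" and p: "p \<le> 1"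
  shows "real (sum d A) powr p \<le> (\<Sum>i\<in>A. real (d i) powr p)"
proof (cases "A = {}")
  case False
  have dD: "d i \<le> sum d A" if "i \<in> A" for i using that A(1) by (intro member_le_sum) auto
  have D: "0 < sum d A" using False A by (metis One_nat_def Suc_le_eq dD equals0I less_le_trans)
  have split: "x powr p = x * x powr (p - 1)" if "0 < x" for x :: real
    using that by (simp add: powr_diff)
  have "real (sum d A) powr p = real (sum d A) * real (sum d A) powr (p - 1)"
    using D by (intro split) linarith
  also have "\<dots> = (\<Sum>i\<in>A. real (d i) * real (sum d A) powr (p - 1))"
    by (simp add: sum_distrib_right)
  also have "\<dots> \<le> (\<Sum>i\<in>A. real (d i) powr p)"
  proof (rule sum_mono)
    fix i assume i: "i \<in> A"
    have "real (d i) * real (sum d A) powr (p - 1) \<le> real (d i) * real (d i) powr (p - 1)"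
      using A(2)[OF i] dD[OF i] p by (intro mult_left_mono powr_mono2') (auto simp del: of_nat_sum)
    also have "\<dots> = real (d i) powr p" using A(2)[OF i] by (simp add: powr_diff)
    finally show "real (d i) * real (sum d A) powr (p - 1) \<le> real (d i) powr p" .
  qed
  finally show ?thesis .
qed simp

text \<open>
  The power mean inequality, from convexity of \<open>x powr p\<close>.
\<close>

lemma powr_sum_le_card:
  fixes d :: "'i \<Rightarrow> nat"
  assumes A: "finite A" "A \<noteq> {}" "\<And>i. i \<in> A \<Longrightarrow> 1 \<le> d i" and p: "1 \<le> p"
  shows "real (sum d A) powr p \<le> real (card A) powr (p - 1) * (\<Sum>i\<in>A. real (d i) powr p)"
proof -
  define n where "n = real (card A)"
  have n: "0 < n" using A by (simp add: n_def card_gt_0_iff)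
  have "(\<Sum>i\<in>A. (1 / n) *\<^sub>R real (d i)) powr p \<le> (\<Sum>i\<in>A. 1 / n * real (d i) powr p)"
    by (rule convex_on_sum[OF A(1,2) powr_convex[OF p]]) (use n A in \<open>auto simp: n_def Suc_le_eq\<close>)
  then have "(real (sum d A) / n) powr p \<le> (\<Sum>i\<in>A. real (d i) powr p) / n"
    by (simp add: sum_divide_distrib)
  then have "real (sum d A) powr p \<le> (\<Sum>i\<in>A. real (d i) powr p) / n * n powr p"
    using n by (simp add: powr_divide pos_divide_le_eq)
  also have "n powr p = n * n powr (p - 1)" using n by (simp add: powr_diff)
  finally show ?thesis using n by (simp add: n_def mult.commute)
qed

text \<open>
  The supremum of the exponents that the embedding below reaches; the two branches agree at \<open>\<alpha> = 1/2\<close>.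
\<close>

definition wreath_exponent :: "real \<Rightarrow> real" where
  "wreath_exponent \<alpha> = (if \<alpha> \<le> 1 / 2 then \<alpha> else 2 * \<alpha> / (2 * \<alpha> + 1))"

lemma wreath_exponent_less_1: "wreath_exponent \<alpha> < 1"
  by (simp add: wreath_exponent_def)

text \<open>
  For \<open>\<alpha> > 1/2\<close> at most \<open>3 * D powr e\<close> sites carry the total \<open>D\<close>, and the power mean inequality
  leaves the exponent \<open>2 * \<alpha> - e * (2 * \<alpha> - 1)\<close>; it equals \<open>2 * e\<close> for \<open>e = 2 * \<alpha> / (2 * \<alpha> + 1)\<close>.
\<close>

lemma lamps_dominate:
  fixes d :: "'i \<Rightarrow> nat"
  assumes A: "finite A" "A \<noteq> {}" "\<And>i. i \<in> A \<Longrightarrow> 1 \<le> d i" "card A \<le> 2 * M + 1"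
    and M: "real M < real (sum d A) powr wreath_exponent \<alpha>" and "0 \<le> \<alpha>"
  shows "real (sum d A) powr (2 * wreath_exponent \<alpha>) \<le>
    3 powr (2 * \<alpha>) * (\<Sum>i\<in>A. real (d i) powr (2 * \<alpha>))"
proof (cases "\<alpha> \<le> 1 / 2")
  case True
  have "real (sum d A) powr (2 * \<alpha>) \<le> 1 * (\<Sum>i\<in>A. real (d i) powr (2 * \<alpha>))"
    using powr_sum_le[of A d "2 * \<alpha>", OF A(1,3)] True by simp
  also have "\<dots> \<le> 3 powr (2 * \<alpha>) * (\<Sum>i\<in>A. real (d i) powr (2 * \<alpha>))"
    using assms(6) by (intro mult_right_mono sum_nonneg) (auto simp: ge_one_powr_ge_zero)
  finally show ?thesis using True by (simp add: wreath_exponent_def)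
next
  case False
  define D where "D = real (sum d A)"
  define e where "e = wreath_exponent \<alpha>"
  have e: "0 \<le> e" "2 * e = 2 * \<alpha> - e * (2 * \<alpha> - 1)"
    using False by (auto simp: e_def wreath_exponent_def field_simps)
  have "1 \<le> sum d A"
  proof -
    obtain i where "i \<in> A" using A(2) by blast
    then have "d i \<le> sum d A" using A(1) by (intro member_le_sum) auto
    then show ?thesis using A(3)[OF \<open>i \<in> A\<close>] by simp
  qed
  then have D: "1 \<le> D" by (simp add: D_def del: of_nat_sum)
  have "1 \<le> D powr e" using D e(1) by (simp add: ge_one_powr_ge_zero)
  then have "real (card A) \<le> 3 * D powr e" using A(4) M by (simp add: D_def e_def)
  then have "real (card A) powr (2 * \<alpha> - 1) \<le> (3 * D powr e) powr (2 * \<alpha> - 1)"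
    using False by (intro powr_mono2) auto
  also have "\<dots> = 3 powr (2 * \<alpha> - 1) * D powr (e * (2 * \<alpha> - 1))"
    by (simp add: powr_mult powr_powr)
  also have "\<dots> \<le> 3 powr (2 * \<alpha>) * D powr (e * (2 * \<alpha> - 1))"
    by (intro mult_right_mono powr_mono) auto
  finally have card: "real (card A) powr (2 * \<alpha> - 1) \<le> 3 powr (2 * \<alpha>) * D powr (e * (2 * \<alpha> - 1))" .
  have "D powr (2 * \<alpha>) \<le> real (card A) powr (2 * \<alpha> - 1) * (\<Sum>i\<in>A. real (d i) powr (2 * \<alpha>))"
    unfolding D_def using False by (intro powr_sum_le_card A(1-3)) auto
  also have "\<dots> \<le> 3 powr (2 * \<alpha>) * D powr (e * (2 * \<alpha> - 1)) * (\<Sum>i\<in>A. real (d i) powr (2 * \<alpha>))"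
    using card by (intro mult_right_mono sum_nonneg) auto
  finally have "D powr (2 * \<alpha>) / D powr (e * (2 * \<alpha> - 1)) \<le> 3 powr (2 * \<alpha>) * (\<Sum>i\<in>A. real (d i) powr (2 * \<alpha>))"
    using D by (simp add: pos_divide_le_eq mult_ac)
  then show ?thesis unfolding D_def[symmetric] e_def[symmetric] e(2) by (simp add: powr_diff)
qed

text \<open>
  The choice of \<open>\<beta>\<close> gives \<open>2 * \<beta> + 1 = s / e + 1\<close> with \<open>e = wreath_exponent \<alpha>\<close>; as \<open>s < e < 1\<close>, this
  lies below \<open>2\<close> and is at least \<open>2 * s / e \<ge> 2 * s\<close>.  If \<open>M \<ge> D\<close> or \<open>M \<ge> D powr e\<close>, the term
  with \<open>M\<close> therefore suffices, and otherwise the lamps do.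
\<close>

lemma lamps_or_range_dominate:
  assumes "0 \<le> \<alpha>" "0 \<le> s" "s < wreath_exponent \<alpha>" "0 < c"
  defines "\<beta> \<equiv> s / (2 * wreath_exponent \<alpha>)"
  shows "\<exists>K>0. \<forall>(A::'i set) d M Q. finite A \<longrightarrow> (\<forall>i\<in>A. 1 \<le> d i) \<longrightarrow> card A \<le> 2 * M + 1 \<longrightarrow>
      real M powr (2 * \<beta> + 1) / 8 \<le> Q \<longrightarrow> c\<^sup>2 * (\<Sum>i\<in>A. real (d i) powr (2 * \<alpha>)) \<le> Q \<longrightarrow>
      (real (sum d A) + real M) powr (2 * s) \<le> K * Q"
proof -
  define e where "e = wreath_exponent \<alpha>"
  define K where "K = 32 + 4 * 3 powr (2 * \<alpha>) / c\<^sup>2"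
  have K: "32 \<le> K" "4 * 3 powr (2 * \<alpha>) / c\<^sup>2 \<le> K" using assms(4) by (auto simp: K_def)
  have e: "0 < e" "e < 1" "s < e" using assms wreath_exponent_less_1 by (auto simp: e_def)
  have "s * e \<le> e * e" using e by (intro mult_right_mono) auto
  have g1: "2 * s / e \<le> 2 * \<beta> + 1"
    using e by (simp add: \<beta>_def flip: e_def) (simp add: field_simps)
  have "s * e \<le> s" using mult_left_mono[of e 1 s] e assms(2) by simp
  then have "2 * s \<le> 2 * s / e" using e by (simp add: field_simps)
  with g1 have g2: "2 * s \<le> 2 * \<beta> + 1" by linarith
  have s1: "s < 1" using e by simp
  have four: "(2 * x) powr (2 * s) \<le> 4 * x powr (2 * s)" if "0 \<le> x" for x :: real
  proof -
    have "2 powr (2 * s) \<le> 2 powr (2::real)" using s1 by (intro powr_mono) auto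
    then have "2 powr (2 * s) \<le> (4::real)" by simp
    then show ?thesis using that by (simp add: powr_mult mult_right_mono)
  qed
  have "(real (sum d A) + real M) powr (2 * s) \<le> K * Q"
    if A: "finite A" "\<And>i. i \<in> A \<Longrightarrow> 1 \<le> d i" "card A \<le> 2 * M + 1"
      and Q: "real M powr (2 * \<beta> + 1) / 8 \<le> Q" "c\<^sup>2 * (\<Sum>i\<in>A. real (d i) powr (2 * \<alpha>)) \<le> Q"
    for A :: "'i set" and d M Q
  proof -
    have Q0: "0 \<le> Q" using order_trans[OF _ Q(1)] by simp
    have range: "real M powr p \<le> 8 * Q" if "p \<le> 2 * \<beta> + 1" for p
    proof (cases "M = 0")
      case False
      then have "real M powr p \<le> real M powr (2 * \<beta> + 1)" using that by (intro powr_mono) auto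
      then show ?thesis using Q(1) by simp
    qed (use Q0 in simp)
    define D where "D = real (sum d A)"
    have "(D + real M) powr (2 * s) \<le> 32 * Q \<or> (D + real M) powr (2 * s) \<le> 4 * 3 powr (2 * \<alpha>) / c\<^sup>2 * Q"
    proof (cases "D \<le> real M")
      case True
      then have "(D + real M) powr (2 * s) \<le> (2 * real M) powr (2 * s)"
        using assms(2) by (intro powr_mono2) (auto simp: D_def sum_nonneg)
      also have "\<dots> \<le> 4 * real M powr (2 * s)" by (rule four) simp
      also have "\<dots> \<le> 32 * Q" using range[OF g2] by simp
      finally show ?thesis ..
    next
      case False
      then have "M < sum d A" by (simp add: D_def del: of_nat_sum)
      then have "1 \<le> sum d A" by linarith
      then have D: "1 \<le> D" by (simp add: D_def del: of_nat_sum)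
      have "(D + real M) powr (2 * s) \<le> (2 * D) powr (2 * s)"
        using False assms(2) by (intro powr_mono2) auto
      also have "\<dots> \<le> 4 * D powr (2 * s)" using D by (intro four) simp
      finally have le: "(D + real M) powr (2 * s) \<le> 4 * D powr (2 * s)" .
      show ?thesis
      proof (cases "D powr e \<le> real M")
        case True
        have "D powr (2 * s) = (D powr e) powr (2 * s / e)" using e by (simp add: powr_powr)
        also have "\<dots> \<le> real M powr (2 * s / e)" using True e assms(2) by (intro powr_mono2) auto
        also have "\<dots> \<le> 8 * Q" by (rule range[OF g1])
        finally show ?thesis using le by simp
      next
        case small: False
        have "A \<noteq> {}" using D by (auto simp: D_def)
        have "D powr (2 * s) \<le> D powr (2 * e)" using D e by (intro powr_mono) auto
        also have "\<dots> \<le> 3 powr (2 * \<alpha>) * (\<Sum>i\<in>A. real (d i) powr (2 * \<alpha>))"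
          unfolding D_def e_def
          using small A \<open>A \<noteq> {}\<close> assms(1) by (intro lamps_dominate[of _ _ M]) (auto simp: D_def e_def)
        also have "\<dots> \<le> 3 powr (2 * \<alpha>) * (Q / c\<^sup>2)"
          using Q(2) assms(4) by (intro mult_left_mono) (auto simp: field_simps)
        finally show ?thesis using le by simp
      qed
    qed
    then show ?thesis
      unfolding D_def using mult_right_mono[OF K(1) Q0] mult_right_mono[OF K(2) Q0] by linarith
  qed
  moreover have "0 < K" using K by simp
  ultimately show ?thesis by (intro exI[of _ K]) auto
qed

section \<open>The embedding of \<open>G \<wr> \<int>\<close>\<close>

lemma sum_le_support_sum:
  fixes q :: "'i \<Rightarrow> real"
  assumes "finite A" "finite {i. q i \<noteq> 0}" "\<And>i. 0 \<le> q i"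
  shows "sum q A \<le> (\<Sum>i | q i \<noteq> 0. q i)"
proof -
  have "sum q A = sum q (A \<inter> {i. q i \<noteq> 0})"
    using assms(1) by (intro sum.mono_neutral_right) auto
  also have "\<dots> \<le> (\<Sum>i | q i \<noteq> 0. q i)"
    using assms by (intro sum_mono2) auto
  finally show ?thesis .
qed

context lamplighter
begin

text \<open>
  For \<open>\<sigma> = 1\<close> the part of \<open>f\<close> on \<open>{k..}\<close>, for \<open>\<sigma> = -1\<close> the part on \<open>{..k}\<close>.
\<close>

definition tail :: "int \<Rightarrow> int \<Rightarrow> (int \<Rightarrow> 'a) \<Rightarrow> int \<Rightarrow> 'a" where
  "tail \<sigma> k f = (\<lambda>z. if \<sigma> * k \<le> \<sigma> * z then f z else \<one>)"

text \<open>
  The coordinate of \<open>(f, x)\<close> at the basis vector indexed by \<open>k\<close> and the tail \<open>h\<close>.  The trivial tail is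
  left out in order that every configuration has finitely many nonzero coordinates.
\<close>

definition range_coord :: "real \<Rightarrow> int \<Rightarrow> int \<times> (int \<Rightarrow> 'a) \<Rightarrow> (int \<Rightarrow> 'a) \<times> int \<Rightarrow> real" where
  "range_coord \<beta> \<sigma> = (\<lambda>(k, h) (f, x).
     if h = tail \<sigma> k f \<and> h \<noteq> (\<lambda>_. \<one>) then ramp \<beta> (\<sigma> * (k - x)) else 0)"

definition range_term :: "real \<Rightarrow> int \<Rightarrow> int \<times> (int \<Rightarrow> 'a) \<Rightarrow>
    (int \<Rightarrow> 'a) \<times> int \<Rightarrow> (int \<Rightarrow> 'a) \<times> int \<Rightarrow> real" where
  "range_term \<beta> \<sigma> i p q = (range_coord \<beta> \<sigma> i p - range_coord \<beta> \<sigma> i q)\<^sup>2"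

definition range_kernel :: "real \<Rightarrow> int \<Rightarrow> (int \<Rightarrow> 'a) \<times> int \<Rightarrow> (int \<Rightarrow> 'a) \<times> int \<Rightarrow> real" where
  "range_kernel \<beta> \<sigma> p q = (\<Sum>i | range_term \<beta> \<sigma> i p q \<noteq> 0. range_term \<beta> \<sigma> i p q)"

lemma range_coord_finite_support:
  assumes \<sigma>: "\<sigma> = 1 \<or> \<sigma> = -1" and p: "p \<in> carrier LG"
  shows "finite {i. range_coord \<beta> \<sigma> i p \<noteq> 0}"
proof -
  obtain f x where px: "p = (f, x)" by (cases p)
  define K where "K = (\<Union>z\<in>{z. f z \<noteq> \<one>}. {min x z..max x z})"
  have "i \<in> (\<lambda>k. (k, tail \<sigma> k f)) ` K" if "range_coord \<beta> \<sigma> i p \<noteq> 0" for i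
  proof -
    obtain k h where i: "i = (k, h)" by (cases i)
    have h: "h = tail \<sigma> k f" "h \<noteq> (\<lambda>_. \<one>)" "0 < \<sigma> * (k - x)"
      using that by (auto simp: i px range_coord_def not_le[symmetric] split: if_splits)
    from h(1,2) obtain z where z: "\<sigma> * k \<le> \<sigma> * z" "f z \<noteq> \<one>"
      by (auto simp: tail_def fun_eq_iff split: if_splits)
    then have "k \<in> {min x z..max x z}" using \<sigma> h(3) by auto
    then have "k \<in> K" using z(2) by (auto simp: K_def)
    then show ?thesis using h(1) by (simp add: i)
  qed
  then have "{i. range_coord \<beta> \<sigma> i p \<noteq> 0} \<subseteq> (\<lambda>k. (k, tail \<sigma> k f)) ` K" by blast
  moreover have "finite K" using p by (simp add: K_def px in_LG)
  ultimately show ?thesis by (meson finite_imageI finite_subset)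
qed

lemma range_term_finite_support:
  assumes \<sigma>: "\<sigma> = 1 \<or> \<sigma> = -1" and "p \<in> carrier LG" "q \<in> carrier LG"
  shows "finite {i. range_term \<beta> \<sigma> i p q \<noteq> 0}"
proof (rule finite_subset)
  show "{i. range_term \<beta> \<sigma> i p q \<noteq> 0} \<subseteq> {i. range_coord \<beta> \<sigma> i p \<noteq> 0} \<union> {i. range_coord \<beta> \<sigma> i q \<noteq> 0}"
    by (auto simp: range_term_def)
qed (use assms range_coord_finite_support in simp)

lemma hilbert_kernel_range:
  assumes "\<sigma> = 1 \<or> \<sigma> = -1"
  shows "hilbert_kernel (carrier LG) (range_kernel \<beta> \<sigma>)"
proof -
  have "hilbert_kernel (carrier LG) (range_term \<beta> \<sigma> i)" for i
    using hilbert_kernel_real[of "carrier LG" "range_coord \<beta> \<sigma> i"] by (simp add: range_term_def[abs_def])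
  then have "hilbert_kernel (carrier LG) (\<lambda>p q. \<Sum>i | range_term \<beta> \<sigma> i p q \<noteq> 0. range_term \<beta> \<sigma> i p q)"
    using W.countable_carrier W.one_closed range_term_finite_support[OF assms]
    by (intro hilbert_kernel_sum[of _ "\<one>\<^bsub>LG\<^esub>"])
  then show ?thesis by (simp add: range_kernel_def[abs_def])
qed

text \<open>
  The lamp at \<open>x\<close> belongs only to tails that start at \<open>x\<close> or earlier (in the direction of \<open>\<sigma>\<close>), and
  these have weight \<open>0\<close>.
\<close>

lemma range_kernel_switch:
  assumes \<sigma>: "\<sigma> = 1 \<or> \<sigma> = -1"
  shows "range_kernel \<beta> \<sigma> (f, x) (f(x := b), x) = 0"
proof -
  have "range_coord \<beta> \<sigma> (k, h) (f(x := b), x) = range_coord \<beta> \<sigma> (k, h) (f, x)" for k h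
  proof (cases "0 < \<sigma> * (k - x)")
    case True
    then have "tail \<sigma> k (f(x := b)) = tail \<sigma> k f"
      by (auto simp: tail_def fun_eq_iff right_diff_distrib)
    then show ?thesis by (simp add: range_coord_def)
  qed (simp add: range_coord_def)
  then have "range_term \<beta> \<sigma> i (f, x) (f(x := b), x) = 0" for i
    by (cases i) (simp add: range_term_def)
  then show ?thesis by (simp add: range_kernel_def)
qed

text \<open>
  The tails do not change, and the weight of each of them moves by one step of \<open>ramp\<close>.
\<close>

lemma range_kernel_move:
  assumes \<sigma>: "\<sigma> = 1 \<or> \<sigma> = -1" and f: "(f, x) \<in> carrier LG"
    and B: "\<And>K. finite K \<Longrightarrow> (\<Sum>t\<in>K. (ramp \<beta> (t + 1) - ramp \<beta> t)\<^sup>2) \<le> B"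
  shows "range_kernel \<beta> \<sigma> (f, x) (f, x + 1) \<le> B"
proof -
  define J where "J = {i. range_term \<beta> \<sigma> i (f, x) (f, x + 1) \<noteq> 0}"
  have J: "finite J" unfolding J_def by (rule range_term_finite_support[OF \<sigma> f LG_move[OF f]])
  have tail: "snd i = tail \<sigma> (fst i) f \<and> snd i \<noteq> (\<lambda>_. \<one>)" if "i \<in> J" for i
    using that by (cases i) (auto simp: J_def range_term_def range_coord_def split: if_splits)
  \<comment> \<open>With this numbering the two weights of the \<open>i\<close>-th vector are \<open>ramp \<beta> (\<tau> i)\<close> and
    \<open>ramp \<beta> (\<tau> i + 1)\<close>, in one order or the other.\<close>
  define \<tau> where "\<tau> i = (if \<sigma> = 1 then fst i - x - 1 else x - fst i)" for i :: "int \<times> (int \<Rightarrow> 'a)"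
  have inj: "inj_on \<tau> J"
  proof (rule inj_onI)
    fix i j assume "i \<in> J" "j \<in> J" "\<tau> i = \<tau> j"
    then have "fst i = fst j" by (auto simp: \<tau>_def split: if_splits)
    with tail[OF \<open>i \<in> J\<close>] tail[OF \<open>j \<in> J\<close>] show "i = j" by (simp add: prod_eq_iff)
  qed
  have summand: "range_term \<beta> \<sigma> i (f, x) (f, x + 1) = (ramp \<beta> (\<tau> i + 1) - ramp \<beta> (\<tau> i))\<^sup>2" if "i \<in> J" for i
  proof -
    have "range_term \<beta> \<sigma> i (f, x) (f, x + 1) =
        (ramp \<beta> (\<sigma> * (fst i - x)) - ramp \<beta> (\<sigma> * (fst i - (x + 1))))\<^sup>2"
      using tail[OF that] by (cases i) (simp add: range_term_def range_coord_def)
    then show ?thesis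
      using \<sigma> by (auto simp: \<tau>_def power2_commute algebra_simps)
  qed
  have "range_kernel \<beta> \<sigma> (f, x) (f, x + 1) = (\<Sum>i\<in>J. (ramp \<beta> (\<tau> i + 1) - ramp \<beta> (\<tau> i))\<^sup>2)"
    using summand by (simp add: range_kernel_def flip: J_def)
  also have "\<dots> = (\<Sum>t\<in>\<tau> ` J. (ramp \<beta> (t + 1) - ramp \<beta> t)\<^sup>2)"
    using inj by (simp add: sum.reindex)
  also have "\<dots> \<le> B" using J by (intro B) simp
  finally show ?thesis .
qed

text \<open>
  At the \<open>j\<close>-th site on the way from \<open>x\<close> to \<open>z\<close> the tails of \<open>f\<close> and \<open>g\<close> differ, so at least one of
  them is nontrivial and its vector occurs in only one of the two images.  Its weight there
  depends on the distance to \<open>x\<close> or to \<open>y\<close>, and both are at least \<open>j - r\<close>.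
\<close>

lemma range_kernel_lower_bound:
  assumes \<sigma>: "\<sigma> = 1 \<or> \<sigma> = -1" and p: "(f, x) \<in> carrier LG" and q: "(g, y) \<in> carrier LG"
    and z: "f z \<noteq> g z" "\<sigma> * (z - x) = int M" and r: "\<bar>x - y\<bar> \<le> int r" "r \<le> M"
    and \<beta>: "0 \<le> \<beta>" "\<beta> \<le> 1 / 2"
  shows "real (M - r) powr (2 * \<beta> + 1) / 2 \<le> range_kernel \<beta> \<sigma> (f, x) (g, y)"
proof -
  define k where "k j = x + \<sigma> * int j" for j
  define h where "h j = (if tail \<sigma> (k j) f \<noteq> (\<lambda>_. \<one>) then tail \<sigma> (k j) f else tail \<sigma> (k j) g)" for j
  have kx: "\<sigma> * (k j - x) = int j" for j using \<sigma> by (auto simp: k_def)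
  have ky: "int j - int r \<le> \<sigma> * (k j - y)" for j using \<sigma> r by (auto simp: k_def)
  have summand: "(ramp \<beta> (int j - int r))\<^sup>2 \<le> range_term \<beta> \<sigma> (k j, h j) (f, x) (g, y)" if "j \<le> M" for j
  proof -
    have "\<sigma> * k j \<le> \<sigma> * z" using z(2) kx[of j] that by (simp add: right_diff_distrib)
    then have "tail \<sigma> (k j) f z \<noteq> tail \<sigma> (k j) g z" using z(1) by (simp add: tail_def)
    then have neq: "tail \<sigma> (k j) f \<noteq> tail \<sigma> (k j) g" by auto
    show ?thesis
    proof (cases "tail \<sigma> (k j) f = (\<lambda>_. \<one>)")
      case True
      then have "range_term \<beta> \<sigma> (k j, h j) (f, x) (g, y) = (ramp \<beta> (\<sigma> * (k j - y)))\<^sup>2"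
        using neq by (auto simp: range_term_def range_coord_def h_def)
      then show ?thesis using ramp_mono[OF \<beta>(1) ky[of j]] by (simp add: power_mono)
    next
      case False
      then have "range_term \<beta> \<sigma> (k j, h j) (f, x) (g, y) = (ramp \<beta> (\<sigma> * (k j - x)))\<^sup>2"
        using neq by (auto simp: range_term_def range_coord_def h_def)
      then show ?thesis using ramp_mono[OF \<beta>(1), of "int j - int r" "int j"] by (simp add: kx power_mono)
    qed
  qed
  have inj: "inj_on (\<lambda>j. (k j, h j)) A" for A
    using \<sigma> by (auto simp: inj_on_def k_def)
  have "real (M - r) powr (2 * \<beta> + 1) / 2 \<le> (\<Sum>i=1..M - r. real i powr (2 * \<beta>))"
    by (rule sum_powr_lower_bound[OF \<beta>])
  also have "\<dots> = (\<Sum>i=1..M - r. (ramp \<beta> (int (i + r) - int r))\<^sup>2)"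
    by (intro sum.cong) (auto simp: ramp_def power2_eq_square simp flip: powr_add)
  also have "\<dots> = (\<Sum>j=1 + r..M - r + r. (ramp \<beta> (int j - int r))\<^sup>2)"
    by (rule sum.shift_bounds_cl_nat_ivl[symmetric])
  also have "\<dots> \<le> (\<Sum>j=1 + r..M - r + r. range_term \<beta> \<sigma> (k j, h j) (f, x) (g, y))"
    using r(2) by (intro sum_mono summand) auto
  also have "\<dots> = sum (\<lambda>i. range_term \<beta> \<sigma> i (f, x) (g, y)) ((\<lambda>j. (k j, h j)) ` {1 + r..M - r + r})"
    by (simp add: sum.reindex[OF inj])
  also have "\<dots> \<le> range_kernel \<beta> \<sigma> (f, x) (g, y)"
    unfolding range_kernel_def
    using range_term_finite_support[OF \<sigma> p q] by (intro sum_le_support_sum) (auto simp: range_term_def)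
  finally show ?thesis .
qed

definition lamp_kernel :: "('a \<Rightarrow> 'a \<Rightarrow> real) \<Rightarrow> (int \<Rightarrow> 'a) \<times> int \<Rightarrow> (int \<Rightarrow> 'a) \<times> int \<Rightarrow> real" where
  "lamp_kernel \<rho> p q = (\<Sum>z | \<rho> (fst p z) (fst q z) \<noteq> 0. \<rho> (fst p z) (fst q z))"

lemma LG_fst: "p \<in> carrier LG \<Longrightarrow> fst p z \<in> carrier G"
  using LG_memD(1)[of "fst p" "snd p"] by simp

lemma lamp_kernel_support:
  assumes "hilbert_kernel (carrier G) \<rho>" "p \<in> carrier LG" "q \<in> carrier LG"
  shows "{z. \<rho> (fst p z) (fst q z) \<noteq> 0} \<subseteq> {z. fst p z \<noteq> fst q z}"
  using hilbert_kernel_refl[OF assms(1) LG_fst[OF assms(3)]] by auto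

lemma hilbert_kernel_lamp:
  assumes \<rho>: "hilbert_kernel (carrier G) \<rho>"
  shows "hilbert_kernel (carrier LG) (lamp_kernel \<rho>)"
proof -
  have "hilbert_kernel (carrier LG) (\<lambda>p q. \<rho> (fst p z) (fst q z))" for z
    by (rule hilbert_kernel_comp[OF \<rho>]) (use LG_fst in auto)
  moreover have "finite {z. \<rho> (fst \<one>\<^bsub>LG\<^esub> z) (fst p z) \<noteq> 0}" if "p \<in> carrier LG" for p
    using lamp_kernel_support[OF \<rho> W.one_closed that]
      finite_difference[of "fst \<one>\<^bsub>LG\<^esub>" "snd \<one>\<^bsub>LG\<^esub>" "fst p" "snd p"] that W.one_closed
    by (metis (no_types, lifting) finite_subset prod.collapse)
  ultimately have "hilbert_kernel (carrier LG)
      (\<lambda>p q. \<Sum>z | \<rho> (fst p z) (fst q z) \<noteq> 0. \<rho> (fst p z) (fst q z))"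
    by (intro hilbert_kernel_sum[OF W.countable_carrier W.one_closed])
  then show ?thesis by (simp add: lamp_kernel_def[abs_def])
qed

lemma lamp_kernel_move:
  assumes "hilbert_kernel (carrier G) \<rho>" "(f, x) \<in> carrier LG"
  shows "lamp_kernel \<rho> (f, x) (f, y) = 0"
  using hilbert_kernel_refl[OF assms(1) LG_memD(1)[OF assms(2)]] by (simp add: lamp_kernel_def)

lemma lamp_kernel_switch:
  assumes "hilbert_kernel (carrier G) \<rho>" "(f, x) \<in> carrier LG"
  shows "lamp_kernel \<rho> (f, x) (f(x := b), x) = \<rho> (f x) b"
proof -
  have "lamp_kernel \<rho> (f, x) (f(x := b), x) = (\<Sum>z\<in>{x}. \<rho> (f z) ((f(x := b)) z))"
    unfolding lamp_kernel_def fst_conv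
    using hilbert_kernel_refl[OF assms(1) LG_memD(1)[OF assms(2)]]
    by (intro sum.mono_neutral_left) auto
  then show ?thesis by simp
qed

lemma lamp_kernel_lower_bound:
  assumes \<rho>: "hilbert_kernel (carrier G) \<rho>" and c: "0 < c"
    and lo: "\<forall>a\<in>carrier G. \<forall>b\<in>carrier G. a \<noteq> b \<longrightarrow> c * real (lamps.wd a b) powr \<alpha> \<le> sqrt (\<rho> a b)"
    and p: "(f, x) \<in> carrier LG" and q: "(g, y) \<in> carrier LG"
  shows "c\<^sup>2 * (\<Sum>z | f z \<noteq> g z. real (lamps.wd (f z) (g z)) powr (2 * \<alpha>)) \<le> lamp_kernel \<rho> (f, x) (g, y)"
proof -
  have fin: "finite {z. f z \<noteq> g z}" by (rule finite_difference[OF p q])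
  have "c\<^sup>2 * real (lamps.wd (f z) (g z)) powr (2 * \<alpha>) \<le> \<rho> (f z) (g z)" if "f z \<noteq> g z" for z
  proof -
    have G: "f z \<in> carrier G" "g z \<in> carrier G" using LG_memD(1) p q by auto
    have "c * real (lamps.wd (f z) (g z)) powr \<alpha> \<le> sqrt (\<rho> (f z) (g z))"
      using lo G that by blast
    then have "(c * real (lamps.wd (f z) (g z)) powr \<alpha>)\<^sup>2 \<le> (sqrt (\<rho> (f z) (g z)))\<^sup>2"
      using c by (intro power_mono) auto
    also have "\<dots> = \<rho> (f z) (g z)" using hilbert_kernel_nonneg[OF \<rho> G] by simp
    finally show ?thesis by (simp add: power2_eq_square mult_ac flip: powr_add)
  qed
  then have "c\<^sup>2 * (\<Sum>z | f z \<noteq> g z. real (lamps.wd (f z) (g z)) powr (2 * \<alpha>)) \<le> (\<Sum>z | f z \<noteq> g z. \<rho> (f z) (g z))"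
    unfolding sum_distrib_left by (intro sum_mono) simp
  also have "\<dots> = lamp_kernel \<rho> (f, x) (g, y)"
    unfolding lamp_kernel_def fst_conv
    using fin lamp_kernel_support[OF \<rho> p q] by (intro sum.mono_neutral_right) auto
  finally show ?thesis .
qed

definition wreath_kernel :: "('a \<Rightarrow> 'a \<Rightarrow> real) \<Rightarrow> real \<Rightarrow> (int \<Rightarrow> 'a) \<times> int \<Rightarrow> (int \<Rightarrow> 'a) \<times> int \<Rightarrow> real" where
  "wreath_kernel \<rho> \<beta> p q = lamp_kernel \<rho> p q + (range_kernel \<beta> 1 p q + (range_kernel \<beta> (-1) p q
     + (real_of_int (snd p) - real_of_int (snd q))\<^sup>2))"

lemma hilbert_kernel_wreath:
  assumes "hilbert_kernel (carrier G) \<rho>"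
  shows "hilbert_kernel (carrier LG) (wreath_kernel \<rho> \<beta>)"
  unfolding wreath_kernel_def[abs_def]
  by (intro hilbert_kernel_add W.countable_carrier hilbert_kernel_lamp[OF assms]
      hilbert_kernel_range hilbert_kernel_real) auto

lemma wreath_kernel_lipschitz:
  assumes \<rho>: "hilbert_kernel (carrier G) \<rho>" and \<beta>: "0 \<le> \<beta>" "\<beta> < 1 / 2"
    and up: "\<forall>a\<in>carrier G. \<forall>b\<in>carrier G. sqrt (\<rho> a b) \<le> L * real (lamps.wd a b)"
  shows "\<exists>L. \<forall>p\<in>carrier LG. \<forall>q\<in>carrier LG. sqrt (wreath_kernel \<rho> \<beta> p q) \<le> L * real (W.wd p q)"
proof -
  note kernel = hilbert_kernel_wreath[OF \<rho>, of \<beta>]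
  obtain B where B: "0 \<le> B" "\<And>K. finite K \<Longrightarrow> (\<Sum>t\<in>K. (ramp \<beta> (t + 1) - ramp \<beta> t)\<^sup>2) \<le> B"
    using ramp_energy[OF \<beta>] by blast
  define C where "C = \<bar>L\<bar> + sqrt (2 * B + 1)"
  have C: "0 \<le> C" using B(1) by (simp add: C_def)
  have switch: "sqrt (wreath_kernel \<rho> \<beta> (f, x) (f(x := b), x)) \<le> C * real (lamps.wd (f x) b)"
    if "(f, x) \<in> carrier LG" "b \<in> carrier G" for f x b
  proof -
    have "sqrt (wreath_kernel \<rho> \<beta> (f, x) (f(x := b), x)) = sqrt (\<rho> (f x) b)"
      by (simp add: wreath_kernel_def lamp_kernel_switch[OF \<rho> that(1)] range_kernel_switch)
    also have "\<dots> \<le> L * real (lamps.wd (f x) b)" using up LG_memD(1)[OF that(1)] that(2) by blast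
    also have "\<dots> \<le> C * real (lamps.wd (f x) b)"
      using B(1) by (intro mult_right_mono) (auto simp: C_def intro: add_increasing2)
    finally show ?thesis .
  qed
  have right: "sqrt (wreath_kernel \<rho> \<beta> (f, x) (f, x + 1)) \<le> C" if "(f, x) \<in> carrier LG" for f x
  proof -
    have "range_kernel \<beta> 1 (f, x) (f, x + 1) \<le> B" "range_kernel \<beta> (-1) (f, x) (f, x + 1) \<le> B"
      using range_kernel_move[OF _ that B(2)] by auto
    then have "wreath_kernel \<rho> \<beta> (f, x) (f, x + 1) \<le> 2 * B + 1"
      by (simp add: wreath_kernel_def lamp_kernel_move[OF \<rho> that])
    then have "sqrt (wreath_kernel \<rho> \<beta> (f, x) (f, x + 1)) \<le> sqrt (2 * B + 1)"
      by (rule real_sqrt_le_mono)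
    then show ?thesis unfolding C_def by linarith
  qed
  have left: "sqrt (wreath_kernel \<rho> \<beta> (f, x + 1) (f, x)) \<le> C" if "(f, x) \<in> carrier LG" for f x
    using right[OF that] hilbert_kernel_commute[OF kernel LG_move[OF that, of "x + 1"] that] by simp
  show ?thesis
    by (rule lipschitz_from_moves[where d = "\<lambda>p q. sqrt (wreath_kernel \<rho> \<beta> p q)",
          OF hilbert_kernel_triangle[OF kernel] _ C switch right left])
      (use hilbert_kernel_refl[OF kernel] in auto)
qed

text \<open>
  If \<open>M < 2 * r\<close> with \<open>r = \<bar>x - y\<bar>\<close>, the coordinate of the position suffices.  Otherwise \<open>M\<close> is attained
  at a differing site, and \<open>M - r \<ge> M / 2\<close>.
\<close>

lemma wreath_kernel_range_bound:
  assumes \<rho>: "hilbert_kernel (carrier G) \<rho>" and \<beta>: "0 \<le> \<beta>" "\<beta> < 1 / 2"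
    and p: "(f, x) \<in> carrier LG" and q: "(g, y) \<in> carrier LG"
  obtains M where "\<bar>x - y\<bar> \<le> int M" "\<And>z. f z \<noteq> g z \<Longrightarrow> \<bar>z - x\<bar> \<le> int M"
    "real M powr (2 * \<beta> + 1) / 8 \<le> wreath_kernel \<rho> \<beta> (f, x) (g, y)"
proof -
  define E where "E = insert \<bar>x - y\<bar> ((\<lambda>z. \<bar>z - x\<bar>) ` {z. f z \<noteq> g z})"
  have E: "finite E" "E \<noteq> {}" using finite_difference[OF p q] by (auto simp: E_def)
  define M where "M = nat (Max E)"
  have "\<bar>x - y\<bar> \<le> Max E" using E by (intro Max_ge) (auto simp: E_def)
  then have M: "int M = Max E" by (simp add: M_def)
  define r where "r = nat \<bar>x - y\<bar>"
  have r: "int r = \<bar>x - y\<bar>" "r \<le> M" using \<open>\<bar>x - y\<bar> \<le> Max E\<close> by (auto simp: r_def M_def)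
  define \<gamma> where "\<gamma> = 2 * \<beta> + 1"
  have \<gamma>: "1 \<le> \<gamma>" "\<gamma> \<le> 2" using \<beta> by (auto simp: \<gamma>_def)
  have nonneg: "0 \<le> lamp_kernel \<rho> (f, x) (g, y)" "0 \<le> range_kernel \<beta> 1 (f, x) (g, y)"
      "0 \<le> range_kernel \<beta> (-1) (f, x) (g, y)"
    using hilbert_kernel_nonneg[OF hilbert_kernel_lamp[OF \<rho>] p q]
      hilbert_kernel_nonneg[OF hilbert_kernel_range p q, of 1 \<beta>]
      hilbert_kernel_nonneg[OF hilbert_kernel_range p q, of "-1" \<beta>] by auto
  have "real M powr \<gamma> / 8 \<le> wreath_kernel \<rho> \<beta> (f, x) (g, y)"
  proof (cases "M < 2 * r \<or> M = 0")
    case True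
    have "real M powr \<gamma> \<le> real M powr 2"
    proof (cases "M = 0")
      case False
      then show ?thesis by (intro powr_mono \<gamma>(2)) simp
    qed simp
    also have "\<dots> = (real M)\<^sup>2" by simp
    also have "\<dots> \<le> (2 * real r)\<^sup>2" using True by (intro power_mono) auto
    also have "\<dots> = 4 * (real_of_int x - real_of_int y)\<^sup>2"
    proof -
      have "real r = \<bar>real_of_int x - real_of_int y\<bar>" using r(1) by linarith
      then show ?thesis by (simp add: power_mult_distrib)
    qed
    finally have "real M powr \<gamma> / 8 \<le> (real_of_int x - real_of_int y)\<^sup>2" 
      using zero_le_power2[of "real_of_int x - real_of_int y"] by linarith
    then show ?thesis using nonneg by (simp add: wreath_kernel_def)
  next
    case False
    have "Max E \<in> E" using E by (rule Max_in)
    then obtain z where z: "f z \<noteq> g z" "\<bar>z - x\<bar> = int M"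
      using False r M by (auto simp: E_def)
    obtain \<sigma> where \<sigma>: "\<sigma> = 1 \<or> \<sigma> = -1" "\<sigma> * (z - x) = int M"
      using z(2) by (cases "0 \<le> z - x") (auto intro: that[of 1] that[of "-1"])
    have half: "real M / 2 \<le> real (M - r)" using False r(2) by (simp add: of_nat_diff)
    have "real M powr \<gamma> / 8 \<le> (real M / 2) powr \<gamma> / 2"
    proof -
      have "2 powr \<gamma> \<le> 2 powr (2::real)" using \<gamma> by (intro powr_mono) auto
      then have "2 powr \<gamma> \<le> (4::real)" by simp
      then have "real M powr \<gamma> / 4 \<le> real M powr \<gamma> / 2 powr \<gamma>" by (intro divide_left_mono) auto
      moreover have "(real M / 2) powr \<gamma> = real M powr \<gamma> / 2 powr \<gamma>" by (simp add: powr_divide)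
      ultimately show ?thesis by linarith
    qed
    also have "\<dots> \<le> real (M - r) powr \<gamma> / 2"
      using half \<gamma> by (intro divide_right_mono powr_mono2) auto
    also have "\<dots> \<le> range_kernel \<beta> \<sigma> (f, x) (g, y)"
      unfolding \<gamma>_def using \<beta> r by (intro range_kernel_lower_bound[OF \<sigma>(1) p q z(1) \<sigma>(2)]) auto
    also have "\<dots> \<le> wreath_kernel \<rho> \<beta> (f, x) (g, y)"
      using \<sigma>(1) nonneg by (auto simp: wreath_kernel_def)
    finally show ?thesis .
  qed
  moreover have "\<bar>z - x\<bar> \<le> int M" if "f z \<noteq> g z" for z
    unfolding M using E that by (intro Max_ge) (auto simp: E_def)
  ultimately show thesis
    using that[of M] \<open>\<bar>x - y\<bar> \<le> Max E\<close> M by (simp add: \<gamma>_def)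
qed

lemma wreath_compression_exponent:
  assumes \<alpha>: "\<alpha> \<in> compression_exponents G S" and s: "0 \<le> s" "s < wreath_exponent \<alpha>"
  shows "s \<in> compression_exponents LG T"
proof -
  obtain c \<rho> L where \<alpha>0: "0 \<le> \<alpha>" and c: "0 < c" and \<rho>: "hilbert_kernel (carrier G) \<rho>"
      and up: "\<forall>a\<in>carrier G. \<forall>b\<in>carrier G. sqrt (\<rho> a b) \<le> L * real (lamps.wd a b)"
      and lo: "\<forall>a\<in>carrier G. \<forall>b\<in>carrier G. a \<noteq> b \<longrightarrow> c * real (lamps.wd a b) powr \<alpha> \<le> sqrt (\<rho> a b)"
    using \<alpha> by (rule lamps.compression_exponentE)
  define \<beta> where "\<beta> = s / (2 * wreath_exponent \<alpha>)"
  have \<beta>: "0 \<le> \<beta>" "\<beta> < 1 / 2" using s by (auto simp: \<beta>_def field_simps)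
  note kernel = hilbert_kernel_wreath[OF \<rho>, of \<beta>]
  obtain L' where L': "\<forall>p\<in>carrier LG. \<forall>q\<in>carrier LG. sqrt (wreath_kernel \<rho> \<beta> p q) \<le> L' * real (W.wd p q)"
    using wreath_kernel_lipschitz[OF \<rho> \<beta> up] by blast
  obtain K where K: "0 < K"
    "\<forall>(A::int set) d M Q. finite A \<longrightarrow> (\<forall>i\<in>A. 1 \<le> d i) \<longrightarrow> card A \<le> 2 * M + 1 \<longrightarrow>
      real M powr (2 * \<beta> + 1) / 8 \<le> Q \<longrightarrow> c\<^sup>2 * (\<Sum>i\<in>A. real (d i) powr (2 * \<alpha>)) \<le> Q \<longrightarrow>
      (real (sum d A) + real M) powr (2 * s) \<le> K * Q"
    using lamps_or_range_dominate[OF \<alpha>0 s c, where ?'i = int] unfolding \<beta>_def by blast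
  obtain C where C: "0 \<le> C" "\<And>f x g y M. (f, x) \<in> carrier LG \<Longrightarrow> (g, y) \<in> carrier LG \<Longrightarrow> \<bar>x - y\<bar> \<le> int M \<Longrightarrow>
     (\<forall>z. f z \<noteq> g z \<longrightarrow> \<bar>z - x\<bar> \<le> int M) \<Longrightarrow>
     real (W.wd (f, x) (g, y)) \<le> C * ((\<Sum>z | f z \<noteq> g z. real (lamps.wd (f z) (g z))) + 5 * real M + 2)"
    using word_dist_upper_bound by meson
  \<comment> \<open>For distinct points \<open>D + M \<ge> 1\<close>, hence \<open>D + 5 * M + 2 \<le> 7 * (D + M)\<close>; adding \<open>1\<close> keeps the constant positive.\<close>
  define K' where "K' = (7 * C + 1) powr (2 * s) * K"
  have K': "0 < K'" using C(1) K(1) by (simp add: K'_def)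
  have lower: "real (W.wd p q) powr (2 * s) \<le> K' * wreath_kernel \<rho> \<beta> p q"
    if pq: "p \<in> carrier LG" "q \<in> carrier LG" "p \<noteq> q" for p q
  proof -
    obtain f x g y where pq_eq: "p = (f, x)" "q = (g, y)" by (cases p; cases q)
    have fg: "(f, x) \<in> carrier LG" "(g, y) \<in> carrier LG" using pq pq_eq by auto
    obtain M where M: "\<bar>x - y\<bar> \<le> int M" "\<And>z. f z \<noteq> g z \<Longrightarrow> \<bar>z - x\<bar> \<le> int M"
        "real M powr (2 * \<beta> + 1) / 8 \<le> wreath_kernel \<rho> \<beta> (f, x) (g, y)"
      using wreath_kernel_range_bound[OF \<rho> \<beta> fg] by blast
    define A where "A = {z. f z \<noteq> g z}"
    define D where "D = (\<Sum>z\<in>A. lamps.wd (f z) (g z))"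
    have A: "finite A" unfolding A_def by (rule finite_difference[OF fg])
    have d1: "1 \<le> lamps.wd (f z) (g z)" if "z \<in> A" for z
      using that lamps.word_dist_eq_0[OF LG_memD(1)[OF fg(1)] LG_memD(1)[OF fg(2)], of z z]
      by (simp add: A_def Suc_le_eq)
    have "A \<subseteq> {x - int M..x + int M}" using M(2) by (force simp: A_def)
    then have "card A \<le> card {x - int M..x + int M}" by (intro card_mono) auto
    then have card: "card A \<le> 2 * M + 1" by simp
    have pos: "1 \<le> D + M"
    proof (cases "A = {}")
      case True
      then have "f = g" by (auto simp: A_def)
      then show ?thesis using pq(3) pq_eq M(1) by auto
    next
      case False
      then obtain z where "z \<in> A" by blast
      then have "lamps.wd (f z) (g z) \<le> D" unfolding D_def using A by (intro member_le_sum) auto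
      then show ?thesis using d1[OF \<open>z \<in> A\<close>] by linarith
    qed
    have "c\<^sup>2 * (\<Sum>z\<in>A. real (lamps.wd (f z) (g z)) powr (2 * \<alpha>)) \<le> lamp_kernel \<rho> (f, x) (g, y)"
      unfolding A_def by (rule lamp_kernel_lower_bound[OF \<rho> c lo fg])
    also have "\<dots> \<le> wreath_kernel \<rho> \<beta> (f, x) (g, y)"
      using hilbert_kernel_nonneg[OF hilbert_kernel_range fg, of 1 \<beta>]
        hilbert_kernel_nonneg[OF hilbert_kernel_range fg, of "-1" \<beta>]
      by (simp add: wreath_kernel_def)
    finally have DM: "(real D + real M) powr (2 * s) \<le> K * wreath_kernel \<rho> \<beta> (f, x) (g, y)"
      unfolding D_def using A d1 card M(3) by (intro K(2)[rule_format]) auto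
    have "real (W.wd (f, x) (g, y)) \<le> (7 * C + 1) * (real D + real M)"
    proof -
      have "real (W.wd (f, x) (g, y)) \<le> C * (real D + 5 * real M + 2)"
        using C(2)[OF fg M(1)] M(2) by (simp add: D_def A_def)
      also have "\<dots> \<le> C * (7 * (real D + real M))"
      proof (rule mult_left_mono[OF _ C(1)])
        have "real 1 \<le> real (D + M)" using pos by (rule of_nat_mono)
        then show "real D + 5 * real M + 2 \<le> 7 * (real D + real M)" by simp
      qed
      also have "\<dots> \<le> (7 * C + 1) * (real D + real M)" by (simp add: algebra_simps)
      finally show ?thesis .
    qed
    then have "real (W.wd (f, x) (g, y)) powr (2 * s) \<le> ((7 * C + 1) * (real D + real M)) powr (2 * s)"
      using s(1) by (intro powr_mono2) auto
    also have "\<dots> = (7 * C + 1) powr (2 * s) * (real D + real M) powr (2 * s)"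
      using C(1) by (simp add: powr_mult)
    also have "\<dots> \<le> (7 * C + 1) powr (2 * s) * (K * wreath_kernel \<rho> \<beta> (f, x) (g, y))"
      using DM by (rule mult_left_mono) simp
    finally show ?thesis by (simp add: K'_def pq_eq mult.assoc)
  qed
  show ?thesis
  proof (rule W.compression_exponentI[OF s(1) _ kernel])
    show "0 < 1 / sqrt K'" using K' by simp
    fix p q assume pq: "p \<in> carrier LG" "q \<in> carrier LG"
    show "sqrt (wreath_kernel \<rho> \<beta> p q) \<le> L' * real (W.wd p q)" using L' pq by blast
    assume "p \<noteq> q"
    have "(real (W.wd p q) powr s)\<^sup>2 = real (W.wd p q) powr (2 * s)"
      by (simp add: power2_eq_square flip: powr_add)
    also have "\<dots> \<le> K' * wreath_kernel \<rho> \<beta> p q" by (rule lower[OF pq \<open>p \<noteq> q\<close>])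
    finally have "real (W.wd p q) powr s \<le> sqrt (K' * wreath_kernel \<rho> \<beta> p q)"
      by (rule real_le_rsqrt)
    then show "1 / sqrt K' * real (W.wd p q) powr s \<le> sqrt (wreath_kernel \<rho> \<beta> p q)"
      using K' by (simp add: real_sqrt_mult field_simps)
  qed
qed

end

section \<open>The compression exponent of \<open>G \<wr> \<int>\<close>\<close>

theorem theorem1p2:
  fixes G :: "('a, 'b) monoid_scheme"
  assumes "group G"
    and "infinite (carrier G)"
    and "finite_symmetric_generating_set G S"
    and "finite_symmetric_generating_set (G \<wr> integer_group) T"
  shows "(hilbert_compression G S \<ge> 1 / 2 \<longrightarrow>
            hilbert_compression (G \<wr> integer_group) T \<ge>
              2 * hilbert_compression G S / (2 * hilbert_compression G S + 1)) \<and>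
         (hilbert_compression G S \<le> 1 / 2 \<longrightarrow>
            hilbert_compression (G \<wr> integer_group) T = hilbert_compression G S)"
proof -
  interpret lamplighter G S T
    unfolding lamplighter_def word_metric_def word_metric_axioms_def
    using assms group_wreath_product[OF assms(1) group_integer_group] by simp
  define E where "E = compression_exponents G S"
  define E' where "E' = compression_exponents LG T"
  define a where "a = hilbert_compression G S"
  define w where "w = hilbert_compression LG T"
  have bdd: "bdd_above E" unfolding E_def by (rule lamps.bdd_above_compression_exponents[OF assms(2)])
  have sub: "E' \<subseteq> E" unfolding E_def E'_def by (rule compression_exponents_subset)
  have bdd': "bdd_above E'" using bdd sub by (rule bdd_above_mono)
  have zero: "0 \<in> E'" unfolding E'_def by (rule W.zero_compression_exponent)
  have a: "a = Sup E" and w: "w = Sup E'"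
    by (simp_all add: a_def w_def E_def E'_def hilbert_compression_def)
  have w0: "0 \<le> w" unfolding w using zero bdd' by (rule cSup_upper)
  have wa: "w \<le> a" unfolding a w using zero bdd sub by (intro cSup_subset_mono) auto
  have low: "wreath_exponent \<alpha> \<le> w" if \<alpha>: "\<alpha> \<in> E" for \<alpha>
  proof (rule dense_le)
    fix s assume s: "s < wreath_exponent \<alpha>"
    show "s \<le> w"
    proof (cases "0 \<le> s")
      case True
      then have "s \<in> E'" using wreath_compression_exponent \<alpha> s unfolding E_def E'_def by blast
      then show ?thesis unfolding w using bdd' by (rule cSup_upper)
    qed (use w0 in simp)
  qed
  have small: "w = a" if "a \<le> 1 / 2"
  proof (rule antisym[OF wa])
    have "\<alpha> \<le> w" if \<alpha>: "\<alpha> \<in> E" for \<alpha>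
    proof -
      have "\<alpha> \<le> a" unfolding a using \<alpha> bdd by (rule cSup_upper)
      then show ?thesis using low[OF \<alpha>] \<open>a \<le> 1 / 2\<close> by (simp add: wreath_exponent_def)
    qed
    then show "a \<le> w" unfolding a using zero sub by (intro cSup_least) auto
  qed
  have large: "2 * a / (2 * a + 1) \<le> w" if "1 / 2 \<le> a"
  proof (cases "a = 1 / 2")
    case True
    have "2 * a / (2 * a + 1) = 1 / 2" unfolding True by simp
    then show ?thesis using small True by linarith
  next
    case False
    show ?thesis
    proof (rule ccontr)
      assume "\<not> ?thesis"
      then have less: "w < 2 * a / (2 * a + 1)" by simp
      have "2 * a / (2 * a + 1) < 1" using that by simp
      then have w1: "w < 1" using less by linarith
      have "w * (2 * a + 1) < 2 * a" using less that by (simp add: pos_less_divide_eq)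
      then have "w < 2 * a * (1 - w)" by (simp add: algebra_simps)
      then have "w / (2 * (1 - w)) < a" using w1 by (simp add: pos_divide_less_eq mult_ac)
      then have "max (1 / 2) (w / (2 * (1 - w))) < Sup E" using False that unfolding a by simp
      moreover have "E \<noteq> {}" using zero sub by blast
      ultimately obtain \<alpha> where "\<alpha> \<in> E" "max (1 / 2) (w / (2 * (1 - w))) < \<alpha>"
        unfolding less_cSup_iff[OF \<open>E \<noteq> {}\<close> bdd] by blast
      then have \<alpha>: "\<alpha> \<in> E" "1 / 2 < \<alpha>" "w / (2 * (1 - w)) < \<alpha>" by (simp_all only: max_less_iff_conj)
      \<comment> \<open>The number \<open>w / (2 * (1 - w))\<close> is the \<open>\<alpha>\<close> with \<open>2 * \<alpha> / (2 * \<alpha> + 1) = w\<close>.\<close>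
      from \<alpha>(3) have "w < 2 * \<alpha> * (1 - w)" using w1 by (simp add: pos_divide_less_eq mult_ac)
      then have "w * (2 * \<alpha> + 1) < 2 * \<alpha>" by (simp add: algebra_simps)
      then have "w < 2 * \<alpha> / (2 * \<alpha> + 1)" using \<alpha>(2) by (simp add: pos_less_divide_eq)
      then show False using low[OF \<alpha>(1)] \<alpha>(2) by (simp add: wreath_exponent_def)
    qed
  qed
  show ?thesis using small large unfolding a_def w_def by blast
qed

end
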